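(* Let $p$ be an odd prime and $\alpha,\beta,\gamma,\delta,\epsilon\in\mathbb Z_p$. Suppose that (i) $\langle-\alpha\rangle_p\leq\min\{\langle-\delta\rangle_p, \langle-\epsilon\rangle_p\}$, $\langle-\beta\rangle_p\leq \langle-\delta\rangle_p$ and $\langle-\gamma\rangle_p\leq \langle-\epsilon\rangle_p$; (ii) $\langle-\alpha\rangle_p+\langle-\beta\rangle_p+\langle-\gamma\rangle_p\leq\langle-\delta\rangle_p+\langle-\epsilon\rangle_p$; (iii) $\langle-\beta\rangle_p+\langle-\gamma\rangle_p\geq \max\{\langle-\delta\rangle_p, \langle-\epsilon\rangle_p\}$; (iv) $(\delta)_{p-1}$, $(\epsilon)_{p-1}$, $(1+\delta-\beta-\gamma)_{p-1}$ and $(1+\epsilon-\beta-\gamma)_{p-1}$ are not divisible by $p^2$. Let $\rho=\delta+\epsilon-\alpha-\beta-\gamma$. Then $$ {}_4F_3\bigg[\begin{matrix}\rho&\alpha&\beta&\gamma\\&1&\delta&\epsilon\end{matrix}\bigg|\,1\bigg]_{p-1}\equiv\frac{\Gamma_p(\beta+\gamma-\delta)\Gamma_p(\beta+\gamma-\epsilon)\Gamma_p(\delta)\Gamma_p(\epsilon)}{\Gamma_p(\delta-\rho)\Gamma_p(\epsilon-\rho)\Gamma_p(\delta-\alpha)\Gamma_p(\epsilon-\alpha)}\cdot{}_4F_3\bigg[\begin{matrix}\rho&\alpha&1-\beta&1-\gamma\\&1&1+\delta-\beta-\gamma&1+\epsilon-\beta-\gamma\end{matrix}\bigg|\,1\bigg]_{p-1}\pmod{p^2}.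 $$
   Context: $\mathbb Z_p$ denotes the $p$-adic integers. For $\alpha\in\mathbb Z_p$, $\langle\alpha\rangle_p$ is the unique integer in $\{0,1,\ldots,p-1\}$ congruent to $\alpha$ modulo $p$. Pochhammer symbol: $(x)_0=1$, $(x)_k=x(x+1)\cdots(x+k-1)$. For $n\ge 0$ the truncated hypergeometric series is ${}_{m+1}F_m\Big[\begin{matrix}\alpha_0&\alpha_1&\ldots&\alpha_m\\&\beta_1&\ldots&\beta_m\end{matrix}\Big|\,z\Big]_n=\sum_{k=0}^{n}\frac{(\alpha_0)_k\cdots(\alpha_m)_k}{(\beta_1)_k\cdots(\beta_m)_k}\cdot\frac{z^k}{k!}$. $\Gamma_p$ is Morita's $p$-adic gamma function: $\Gamma_p(n)=(-1)^n\prod_{1\le j<n,\ p\nmid j}j$ for integers $n\ge1$, $\Gamma_p(0)=1$, extended to $\mathbb Z_p$ by continuity. For $x,y\in\mathbb Q_p$, $x\equiv y\pmod{p^2}$ means $x-y\in p^2\mathbb Z_p$. *)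

theory Defs
  imports
    Complex_Main
    "HOL-Computational_Algebra.Polynomial_Factorial"
    "Berlekamp_Zassenhaus.Finite_Field"
begin

section \<open>The ring of p-adic integers\<close>

text \<open>
  The prime is carried by the type: for \<open>'p :: prime_card\<close> the prime is \<open>CARD('p)\<close>, and
  \<open>'p padic_int\<close> is the inverse limit of the rings of integers modulo \<open>CARD('p) ^ n\<close>.  A
  p-adic integer is the coherent sequence of its least nonnegative residues.
\<close>

typedef ('p :: prime_card) padic_int =
  "{x :: nat \<Rightarrow> int. \<forall>n. x n \<in> {0..<int CARD('p) ^ n} \<and> x (Suc n) mod int CARD('p) ^ n = x n}"
  morphisms padic_approx Abs_padic_int
  by (rule exI[of _ "\<lambda>_. 0"]) (auto simp: prime_gt_0_nat[OF prime_card])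

setup_lifting type_definition_padic_int

lemma card_pos: "int CARD('p :: prime_card) > 0"
  using prime_gt_0_nat[OF prime_card[where 'a = 'p]] by simp

lemma mod_power_Suc_mod: "(a mod (b :: int) ^ Suc n) mod b ^ n = a mod b ^ n"
  by (rule mod_mod_cancel) simp

instantiation padic_int :: (prime_card) comm_ring_1
begin

lift_definition zero_padic_int :: "'a padic_int" is "\<lambda>_. 0"
  using card_pos[where 'p = 'a] by simp

lift_definition one_padic_int :: "'a padic_int" is "\<lambda>n. 1 mod int CARD('a) ^ n"
  using card_pos[where 'p = 'a] by (simp add: mod_power_Suc_mod del: power_Suc)

lift_definition plus_padic_int :: "'a padic_int \<Rightarrow> 'a padic_int \<Rightarrow> 'a padic_int"
  is "\<lambda>x y n. (x n + y n) mod int CARD('a) ^ n"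
proof -
  fix x y :: "nat \<Rightarrow> int" and n
  assume x: "\<And>n. x n \<in> {0..<int CARD('a) ^ n} \<and> x (Suc n) mod int CARD('a) ^ n = x n"
    and y: "\<And>n. y n \<in> {0..<int CARD('a) ^ n} \<and> y (Suc n) mod int CARD('a) ^ n = y n"
  have "(x (Suc n) + y (Suc n)) mod int CARD('a) ^ n = (x n + y n) mod int CARD('a) ^ n"
    by (metis x y mod_add_eq)
  then show "(x n + y n) mod int CARD('a) ^ n \<in> {0..<int CARD('a) ^ n} \<and>
      (x (Suc n) + y (Suc n)) mod int CARD('a) ^ Suc n mod int CARD('a) ^ n
        = (x n + y n) mod int CARD('a) ^ n"
    using card_pos[where 'p = 'a] by (simp add: mod_power_Suc_mod del: power_Suc)
qed

lift_definition times_padic_int :: "'a padic_int \<Rightarrow> 'a padic_int \<Rightarrow> 'a padic_int"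
  is "\<lambda>x y n. (x n * y n) mod int CARD('a) ^ n"
proof -
  fix x y :: "nat \<Rightarrow> int" and n
  assume x: "\<And>n. x n \<in> {0..<int CARD('a) ^ n} \<and> x (Suc n) mod int CARD('a) ^ n = x n"
    and y: "\<And>n. y n \<in> {0..<int CARD('a) ^ n} \<and> y (Suc n) mod int CARD('a) ^ n = y n"
  have "(x (Suc n) * y (Suc n)) mod int CARD('a) ^ n = (x n * y n) mod int CARD('a) ^ n"
    by (metis x y mod_mult_eq)
  then show "(x n * y n) mod int CARD('a) ^ n \<in> {0..<int CARD('a) ^ n} \<and>
      (x (Suc n) * y (Suc n)) mod int CARD('a) ^ Suc n mod int CARD('a) ^ n
        = (x n * y n) mod int CARD('a) ^ n"
    using card_pos[where 'p = 'a] by (simp add: mod_power_Suc_mod del: power_Suc)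
qed

lift_definition uminus_padic_int :: "'a padic_int \<Rightarrow> 'a padic_int"
  is "\<lambda>x n. (- x n) mod int CARD('a) ^ n"
proof -
  fix x :: "nat \<Rightarrow> int" and n
  assume x: "\<And>n. x n \<in> {0..<int CARD('a) ^ n} \<and> x (Suc n) mod int CARD('a) ^ n = x n"
  have "(- x (Suc n)) mod int CARD('a) ^ n = (- x n) mod int CARD('a) ^ n"
    by (metis x mod_minus_eq)
  then show "(- x n) mod int CARD('a) ^ n \<in> {0..<int CARD('a) ^ n} \<and>
      (- x (Suc n)) mod int CARD('a) ^ Suc n mod int CARD('a) ^ n = (- x n) mod int CARD('a) ^ n"
    using card_pos[where 'p = 'a] by (simp add: mod_power_Suc_mod del: power_Suc)
qed

definition minus_padic_int :: "'a padic_int \<Rightarrow> 'a padic_int \<Rightarrow> 'a padic_int"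
  where "minus_padic_int x y = x + (- y)"

instance
proof
  fix a b c :: "'a padic_int"
  show "a + b + c = a + (b + c)"
    by transfer (auto simp: fun_eq_iff mod_simps add.assoc)
  show "a + b = b + a"
    by transfer (simp add: add.commute)
  show "0 + a = a"
    by transfer (auto simp: fun_eq_iff)
  show "- a + a = 0"
    by transfer (auto simp: fun_eq_iff mod_simps)
  show "a - b = a + - b"
    by (simp add: minus_padic_int_def)
  show "a * b * c = a * (b * c)"
    by transfer (auto simp: fun_eq_iff mod_simps mult.assoc)
  show "a * b = b * a"
    by transfer (simp add: mult.commute)
  show "1 * a = a"
    by transfer (auto simp: fun_eq_iff mod_simps)
  show "(a + b) * c = a * c + b * c"
    by transfer (auto simp: fun_eq_iff mod_simps distrib_right)
  show "(0 :: 'a padic_int) \<noteq> 1"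
  proof (transfer, rule notI)
    assume "(\<lambda>_. 0) = (\<lambda>n. 1 mod int CARD('a) ^ n)"
    then have "1 mod int CARD('a) ^ 1 = 0" by metis
    then show False
      using prime_gt_1_nat[OF prime_card[where 'a = 'a]] by simp
  qed
qed

end

lemma padic_approx_range:
  "0 \<le> padic_approx (x :: 'p :: prime_card padic_int) n" "padic_approx x n < int CARD('p) ^ n"
  using padic_approx[of x] by auto

lemma padic_approx_Suc_mod:
  "padic_approx (x :: 'p :: prime_card padic_int) (Suc n) mod int CARD('p) ^ n = padic_approx x n"
  using padic_approx[of x] by auto

lemma padic_approx_add_mod:
  "padic_approx (x :: 'p :: prime_card padic_int) (n + k) mod int CARD('p) ^ n = padic_approx x n"
proof (induction k)
  case 0
  then show ?case using padic_approx_range[of x n] by simp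
next
  case (Suc k)
  have "padic_approx x (n + Suc k) mod int CARD('p) ^ n
      = (padic_approx x (Suc (n + k)) mod int CARD('p) ^ (n + k)) mod int CARD('p) ^ n"
    by (simp add: mod_mod_cancel le_imp_power_dvd del: power_Suc)
  then show ?case using Suc by (simp add: padic_approx_Suc_mod)
qed

lemma padic_int_eqI:
  "(\<And>n. padic_approx x n = padic_approx y n) \<Longrightarrow> (x :: 'p :: prime_card padic_int) = y"
  by (simp add: padic_approx_inject[symmetric] fun_eq_iff)

lemma padic_approx_0 [simp]: "padic_approx 0 n = 0"
  by transfer simp

lemma padic_approx_mult:
  "padic_approx (x * y :: 'p :: prime_card padic_int) n
    = (padic_approx x n * padic_approx y n) mod int CARD('p) ^ n"
  by transfer simp

lemma padic_approx_add:
  "padic_approx (x + y :: 'p :: prime_card padic_int) n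
    = (padic_approx x n + padic_approx y n) mod int CARD('p) ^ n"
  by transfer simp

lemma padic_approx_diff:
  "padic_approx (x - y :: 'p :: prime_card padic_int) n
    = (padic_approx x n - padic_approx y n) mod int CARD('p) ^ n"
  unfolding minus_padic_int_def by transfer (simp add: mod_simps)

lemma padic_approx_of_nat:
  "padic_approx (of_nat m :: 'p :: prime_card padic_int) n = int m mod int CARD('p) ^ n"
proof (induction m)
  case (Suc m)
  have "padic_approx (1 :: 'p padic_int) n = 1 mod int CARD('p) ^ n" by transfer simp
  with Suc show ?case by (simp add: padic_approx_add mod_simps)
qed simp

lemma padic_int_neq_0E:
  assumes "(x :: 'p :: prime_card padic_int) \<noteq> 0"
  obtains n where "padic_approx x n \<noteq> 0"
  using assms padic_int_eqI[of x 0] by auto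

instance padic_int :: (prime_card) idom
proof
  fix x y :: "'a padic_int"
  assume "x \<noteq> 0" "y \<noteq> 0"
  then obtain n m where n: "padic_approx x n \<noteq> 0" and m: "padic_approx y m \<noteq> 0"
    by (metis padic_int_neq_0E)
  let ?p = "int CARD('a)"
  have p: "prime ?p" using prime_card[where 'a = 'a] by simp
  let ?a = "padic_approx x (n + m)" and ?b = "padic_approx y (n + m)"
  have a: "\<not> ?p ^ n dvd ?a"
    using n padic_approx_add_mod[of x n m] by (auto simp: dvd_eq_mod_eq_0)
  have b: "\<not> ?p ^ m dvd ?b"
    using m padic_approx_add_mod[of y m n] by (auto simp: dvd_eq_mod_eq_0 add.commute)
  have a0: "?a \<noteq> 0" and b0: "?b \<noteq> 0" using a b by auto
  have "\<not> ?p ^ (n + m) dvd ?a * ?b"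
  proof
    assume "?p ^ (n + m) dvd ?a * ?b"
    then have "n + m \<le> multiplicity ?p (?a * ?b)"
      using p a0 b0 by (intro multiplicity_geI) auto
    also have "\<dots> = multiplicity ?p ?a + multiplicity ?p ?b"
      using p a0 b0 by (intro prime_elem_multiplicity_mult_distrib) auto
    finally have "n \<le> multiplicity ?p ?a \<or> m \<le> multiplicity ?p ?b" by linarith
    with a b show False using multiplicity_dvd' by blast
  qed
  then have "padic_approx (x * y) (n + m) \<noteq> 0"
    by (simp add: padic_approx_mult dvd_eq_mod_eq_0)
  then show "x * y \<noteq> 0" by auto
qed

lemma nat_eq_if_cong_powers:
  assumes "b > 1" and "\<And>n. int m mod int b ^ n = int k mod int b ^ n"
  shows "m = k"
proof -
  define n where "n = m + k"
  have "n < b ^ n"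
    using assms(1) by (intro power_gt_expt) simp
  then have "int m < int b ^ n" "int k < int b ^ n"
    unfolding n_def by (simp_all flip: of_nat_power)
  with assms(2)[of n] show ?thesis by simp
qed

instance padic_int :: (prime_card) ring_char_0
proof (standard, rule injI)
  fix m k :: nat
  assume eq: "of_nat m = (of_nat k :: 'a padic_int)"
  show "m = k"
  proof (rule nat_eq_if_cong_powers)
    show "CARD('a) > 1" using prime_gt_1_nat[OF prime_card] .
    show "int m mod int CARD('a) ^ n = int k mod int CARD('a) ^ n" for n
      using arg_cong[OF eq, of "\<lambda>x. padic_approx x n"] by (simp add: padic_approx_of_nat)
  qed
qed

text \<open>Divisibility by a power of the prime is the vanishing of the corresponding residue.\<close>

lemma padic_power_dvd_iff:
  "of_nat CARD('p) ^ n dvd (x :: 'p :: prime_card padic_int) \<longleftrightarrow> padic_approx x n = 0"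
proof
  let ?p = "int CARD('p)"
  assume "of_nat CARD('p) ^ n dvd x"
  then obtain z where "x = of_nat (CARD('p) ^ n) * z" by (auto simp: dvd_def)
  then show "padic_approx x n = 0"
    by (simp add: padic_approx_mult padic_approx_of_nat del: of_nat_power) simp
next
  let ?p = "int CARD('p)"
  assume 0: "padic_approx x n = 0"
  have pos: "?p > 0" by (rule card_pos)
  define z where "z k = padic_approx x (n + k) div ?p ^ n" for k
  have z: "padic_approx x (n + k) = ?p ^ n * z k" for k
    using padic_approx_add_mod[of x n k] 0 unfolding z_def by auto
  have range: "z k \<in> {0..<?p ^ k}" for k
  proof -
    have "?p ^ n * z k < ?p ^ n * ?p ^ k"
      using padic_approx_range(2)[of x "n + k"] by (simp add: z power_add)
    moreover have "0 \<le> ?p ^ n * z k"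
      using padic_approx_range(1)[of x "n + k"] by (simp add: z)
    ultimately show ?thesis using zero_less_power[OF pos, of n] by (auto simp: zero_le_mult_iff)
  qed
  have coh: "z (Suc k) mod ?p ^ k = z k" for k
  proof -
    have "?p ^ n * (z (Suc k) mod ?p ^ k) = (?p ^ n * z (Suc k)) mod ?p ^ (n + k)"
      by (simp add: power_add)
    also have "\<dots> = ?p ^ n * z k"
      using padic_approx_Suc_mod[of x "n + k"] z[of "Suc k"] z[of k] by simp
    finally show ?thesis using pos by simp
  qed
  define y :: "'p padic_int" where "y = Abs_padic_int z"
  have y: "padic_approx y = z"
    unfolding y_def using range coh by (intro Abs_padic_int_inverse) auto
  have "x = of_nat (CARD('p) ^ n) * y"
  proof (rule padic_int_eqI)
    fix m
    have "padic_approx (of_nat (CARD('p) ^ n) * y) m = (?p ^ n * z m) mod ?p ^ m"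
      by (simp add: padic_approx_mult padic_approx_of_nat y mod_simps del: of_nat_power)
         (simp add: mod_simps)
    also have "\<dots> = padic_approx x (m + n) mod ?p ^ m"
      by (simp only: z add.commute[of m n])
    finally show "padic_approx x m = padic_approx (of_nat (CARD('p) ^ n) * y) m"
      by (simp add: padic_approx_add_mod)
  qed
  then show "of_nat CARD('p) ^ n dvd x" by simp
qed

section \<open>The p-adic metric\<close>

definition padic_val :: "'p :: prime_card padic_int \<Rightarrow> nat" where
  "padic_val x = (GREATEST n. of_nat CARD('p) ^ n dvd x)"

lemma padic_val_iff:
  assumes "(x :: 'p :: prime_card padic_int) \<noteq> 0"
  shows "of_nat CARD('p) ^ n dvd x \<longleftrightarrow> n \<le> padic_val x"
proof -
  let ?P = "\<lambda>n. of_nat CARD('p) ^ n dvd x"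
  obtain m where "padic_approx x m \<noteq> 0" using padic_int_neq_0E[OF assms] .
  then have m: "\<not> ?P m" by (simp add: padic_power_dvd_iff)
  have bound: "\<forall>n. ?P n \<longrightarrow> n \<le> m"
    using m by (meson dvd_trans le_imp_power_dvd nle_le)
  have "?P 0" by simp
  then have "?P (padic_val x)" unfolding padic_val_def using GreatestI_nat[of ?P 0 m] bound by blast
  moreover have "n \<le> padic_val x" if "?P n" for n
    unfolding padic_val_def using Greatest_le_nat[of ?P n m] that bound by blast
  ultimately show ?thesis by (meson dvd_trans le_imp_power_dvd)
qed

instantiation padic_int :: (prime_card) metric_space
begin

definition dist_padic_int :: "'a padic_int \<Rightarrow> 'a padic_int \<Rightarrow> real" where
  "dist_padic_int x y = (if x = y then 0 else 1 / real CARD('a) ^ padic_val (x - y))"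

definition uniformity_padic_int :: "('a padic_int \<times> 'a padic_int) filter" where
  "uniformity_padic_int = (INF e\<in>{0<..}. principal {(x, y). dist x y < e})"

definition open_padic_int :: "'a padic_int set \<Rightarrow> bool" where
  "open_padic_int U \<longleftrightarrow> (\<forall>x\<in>U. eventually (\<lambda>(x', y). x' = x \<longrightarrow> y \<in> U) uniformity)"

instance
proof
  fix x y z :: "'a padic_int"
  let ?p = "of_nat CARD('a) :: 'a padic_int"
  have p1: "real CARD('a) > 1" using prime_gt_1_nat[OF prime_card[where 'a = 'a]] by simp
  show "dist x y = 0 \<longleftrightarrow> x = y"
    using p1 by (simp add: dist_padic_int_def)
  have le: "dist x y \<le> 1 / real CARD('a) ^ n" if "?p ^ n dvd x - y" for n
  proof (cases "x = y")
    case False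
    then have "n \<le> padic_val (x - y)" using that padic_val_iff[of "x - y" n] by simp
    then show ?thesis using False p1
      by (auto simp: dist_padic_int_def intro!: divide_left_mono power_increasing)
  qed (simp add: dist_padic_int_def)
  have nonneg: "dist u v \<ge> 0" for u v :: "'a padic_int"
    using p1 by (simp add: dist_padic_int_def)
  show "dist x y \<le> dist x z + dist y z"
  proof (cases "x = z \<or> y = z")
    case True
    have "padic_val (z - y) = padic_val (y - z)"
      unfolding padic_val_def by (metis dvd_minus_iff minus_diff_eq)
    with True show ?thesis by (auto simp: dist_padic_int_def)
  next
    case False
    define n where "n = min (padic_val (x - z)) (padic_val (y - z))"
    have "?p ^ n dvd x - z" "?p ^ n dvd y - z"
      using False by (simp_all add: padic_val_iff n_def)
    then have "?p ^ n dvd (x - z) - (y - z)" by (rule dvd_diff)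
    then have "dist x y \<le> 1 / real CARD('a) ^ n" using le[of n] by simp
    also have "1 / real CARD('a) ^ n \<le> dist x z + dist y z"
    proof (cases "n = padic_val (x - z)")
      case True
      then show ?thesis using False nonneg[of y z] by (simp add: dist_padic_int_def)
    next
      case F: False
      then have "n = padic_val (y - z)" by (auto simp: n_def min_def split: if_splits)
      then show ?thesis using False nonneg[of x z] by (simp add: dist_padic_int_def)
    qed
    finally show ?thesis .
  qed
qed (fact uniformity_padic_int_def open_padic_int_def)+

end

section \<open>Residues and the field of p-adic numbers\<close>

definition padic_residue :: "'p :: prime_card padic_int \<Rightarrow> nat" where
  "padic_residue a = (THE r. r < CARD('p) \<and> of_nat CARD('p) dvd (a - of_nat r))"

lemma padic_residue_unique:
  "\<exists>!r. r < CARD('p) \<and> of_nat CARD('p) dvd (a - of_nat r :: 'p :: prime_card padic_int)"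
proof -
  let ?p = "int CARD('p)"
  let ?d = "padic_approx a 1"
  have d: "0 \<le> ?d" "?d < ?p" using padic_approx_range[of a 1] by simp_all
  have "of_nat CARD('p) dvd (a - of_nat r) \<longleftrightarrow> r = nat ?d" if "r < CARD('p)" for r
  proof -
    have "of_nat CARD('p) dvd (a - of_nat r) \<longleftrightarrow> (?d - int r) mod ?p = 0"
      using padic_power_dvd_iff[of 1 "a - of_nat r"]
      by (simp add: padic_approx_diff padic_approx_of_nat mod_simps)
    also have "\<dots> \<longleftrightarrow> ?d mod ?p = int r mod ?p" by (simp add: mod_eq_dvd_iff dvd_eq_mod_eq_0)
    also have "\<dots> \<longleftrightarrow> r = nat ?d" using d that by auto
    finally show ?thesis .
  qed
  moreover have "nat ?d < CARD('p)" using d by linarith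
  ultimately show ?thesis by blast
qed

type_synonym 'p padic = "'p padic_int fract"

instance fract :: ("{idom, ring_char_0}") field_char_0
proof (standard, rule injI)
  fix m n :: nat
  assume "of_nat m = (of_nat n :: 'a fract)"
  then have "Fract (of_nat m) (1 :: 'a) = Fract (of_nat n) 1"
    by (simp only: of_nat_fract)
  then show "m = n" by (simp add: eq_fract)
qed

text \<open>Congruence of p-adic numbers modulo the N-th power of the prime, i.e. modulo the
  corresponding ideal of the p-adic integers.\<close>

definition padic_cong :: "nat \<Rightarrow> 'p :: prime_card padic \<Rightarrow> 'p padic \<Rightarrow> bool" where
  "padic_cong N x y \<longleftrightarrow> (\<exists>z :: 'p padic_int. x - y = to_fract (of_nat CARD('p) ^ N * z))"

section \<open>Truncated hypergeometric series and the p-adic gamma function\<close>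

definition hypergeom_trunc :: "'a :: field_char_0 list \<Rightarrow> 'a list \<Rightarrow> 'a \<Rightarrow> nat \<Rightarrow> 'a" where
  "hypergeom_trunc as bs z n =
     (\<Sum>k=0..n. (\<Prod>a\<leftarrow>as. pochhammer a k) / (\<Prod>b\<leftarrow>bs. pochhammer b k) * (z ^ k / fact k))"

text \<open>
  Morita's function.  By density of the natural numbers at most one function fits the description;
  that one exists (i.e. that the prescribed values are p-adically continuous) follows from the
  generalised Wilson theorem.
\<close>

definition padic_Gamma :: "'p :: prime_card padic_int \<Rightarrow> 'p padic_int" where
  "padic_Gamma = (THE f. continuous_on UNIV f \<and> f 0 = 1 \<and>
     (\<forall>n\<ge>1. f (of_nat n) = (-1) ^ n * of_nat (\<Prod>j | 1 \<le> j \<and> j < n \<and> \<not> CARD('p) dvd j. j)))"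

end

theory Submission
  imports Defs "HOL-Number_Theory.Residue_Primitive_Roots"
begin

text \<open>
  Let \<open>a\<close> and \<open>r\<close> be the residues of \<open>-\<alpha>\<close> and \<open>-\<rho>\<close>.  Modulo \<open>p\<^sup>2\<close> both series may be truncated after
  \<open>M = max a r\<close>, because in every later term \<open>(\<rho>)\<^sub>k (\<alpha>)\<^sub>k\<close> contributes \<open>p\<^sup>2\<close> while the remaining quotient is
  \<open>p\<close>-integral; up to \<open>M\<close> no denominator is divisible by \<open>p\<close>.  Hence the difference of the two sides is,
  modulo \<open>p\<^sup>2\<close>, an affine function along every line whose direction is divisible by \<open>p\<close> (for the gamma
  factors this is a consequence of \<open>\<Gamma>\<^sub>p (p m) \<equiv> 1 + p m c\<close>).  Choose such a line through the given point, at
  parameter \<open>0\<close>, so that \<open>\<alpha> = -a\<close> at parameter \<open>1\<close> and \<open>\<rho> = -r\<close> at parameter \<open>-1\<close>, keeping \<open>\<beta>\<close>, \<open>\<gamma>\<close>, \<open>\<epsilon>\<close> fixed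
  and letting \<open>\<delta>\<close> restore the balancing condition.  At both parameters the series terminate and the two
  sides agree by Whipple's transformation, so twice the difference at \<open>0\<close> vanishes modulo \<open>p\<^sup>2\<close>.
\<close>

section \<open>Whipple's transformation\<close>

text \<open>Pascal's rule under the summation sign; it drives the passage from \<open>k\<close> to
  \<open>Suc k\<close> below.\<close>

lemma sum_binomial_Suc:
  fixes h :: "nat \<Rightarrow> 'a :: comm_ring_1"
  shows "(\<Sum>j\<le>Suc k. of_nat (Suc k choose j) * h j) = (\<Sum>j\<le>k. of_nat (k choose j) * (h j + h (Suc j)))"
proof -
  have "(\<Sum>j\<le>Suc k. of_nat (Suc k choose j) * h j)
      = h 0 + (\<Sum>j\<le>k. of_nat (k choose Suc j) * h (Suc j)) + (\<Sum>j\<le>k. of_nat (k choose j) * h (Suc j))"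
    unfolding sum.atMost_Suc_shift by (simp add: algebra_simps sum.distrib)
  also have "h 0 + (\<Sum>j\<le>k. of_nat (k choose Suc j) * h (Suc j)) = (\<Sum>j\<le>Suc k. of_nat (k choose j) * h j)"
    unfolding sum.atMost_Suc_shift by simp
  also have "\<dots> = (\<Sum>j\<le>k. of_nat (k choose j) * h j)" by (simp add: binomial_eq_0)
  finally show ?thesis by (simp add: algebra_simps sum.distrib)
qed

text \<open>Both symbols contain \<open>pochhammer (z + 1) m\<close>; the remaining factors
  \<open>z + 1 + m\<close> and \<open>z\<close> differ by \<open>Suc m\<close>.\<close>

lemma pochhammer_shift_diff:
  fixes z :: "'a :: comm_ring_1"
  shows "pochhammer (z + 1) (Suc m) = pochhammer z (Suc m) + of_nat (Suc m) * pochhammer (z + 1) m"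
  unfolding pochhammer_rec[of z] pochhammer_rec'[of "z + 1"] by (simp add: algebra_simps)

text \<open>Clearing \<open>pochhammer d k * pochhammer (d - x - y) k\<close> from the classical
  evaluation of a terminating balanced 3F2 leaves a polynomial identity, meaningful in every
  commutative ring. The left side satisfies a recurrence in \<open>k\<close> with a shift of
  \<open>d\<close>, and the product on the right satisfies the same one.\<close>

theorem pfaff_saalschuetz:
  fixes d x y :: "'a :: comm_ring_1"
  shows "(\<Sum>j\<le>k. of_nat (k choose j) * (pochhammer x j * pochhammer y j * pochhammer (d + of_nat j) (k - j)
             * pochhammer (d - x - y) (k - j)))
          = pochhammer (d - x) k * pochhammer (d - y) k"
proof -
  define S where "S d k = (\<Sum>j\<le>k. of_nat (k choose j) * (pochhammer x j * pochhammer y j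
      * pochhammer (d + of_nat j) (k - j) * pochhammer (d - x - y) (k - j)))" for d :: 'a and k
  have step: "S d (Suc k) = (of_nat k * (d + of_nat k) + (d - x) * (d - y)) * S d k
      + (d - x) * (d - y) * of_nat k * (d - x - y) * S (d + 1) (k - 1)" for d k
  proof -
    let ?e = "d - x - y" and ?bc = "(d - x) * (d - y)"
    define X where "X j = of_nat (k choose j) * (pochhammer x j * pochhammer y j * pochhammer ?e (k - j))" for j
    \<comment> \<open>After Pascal's rule the two neighbouring terms have the cofactors
      \<open>(d + j) * (d - x - y + k - j)\<close> and \<open>(x + j) * (y + j)\<close>, whose sum
      is \<open>(d - x) * (d - y) + k * (d + j)\<close>.\<close>
    have "S d (Suc k) = (\<Sum>j\<le>k. X j * pochhammer (d + of_nat j + 1) (k - j) * (?bc + of_nat k * (d + of_nat j)))"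
      unfolding S_def sum_binomial_Suc
    proof (rule sum.cong[OF refl])
      fix j assume "j \<in> {..k}"
      then obtain m where k: "k = j + m" by (auto simp: le_iff_add)
      show "of_nat (k choose j) *
          (pochhammer x j * pochhammer y j * pochhammer (d + of_nat j) (Suc k - j) * pochhammer ?e (Suc k - j) +
           pochhammer x (Suc j) * pochhammer y (Suc j) * pochhammer (d + of_nat (Suc j)) (Suc k - Suc j)
             * pochhammer ?e (Suc k - Suc j))
         = X j * pochhammer (d + of_nat j + 1) (k - j) * (?bc + of_nat k * (d + of_nat j))"
        unfolding k X_def
        by (simp add: Suc_diff_le pochhammer_rec[of "d + of_nat j"] pochhammer_rec'[of x] pochhammer_rec'[of y]
            pochhammer_rec'[of ?e]) (simp add: algebra_simps)
    qed
    \<comment> \<open>The factor \<open>d + j\<close> turns the shifted symbol back into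
      \<open>pochhammer (d + j) (k - j)\<close> times \<open>d + k\<close>. The part with
      \<open>?bc\<close> is split by the difference formula into a term of \<open>S d k\<close> and
      a remainder.\<close>
    also have "\<dots> = (\<Sum>j\<le>k. (of_nat k * (d + of_nat k) + ?bc) * (X j * pochhammer (d + of_nat j) (k - j))
        + ?bc * (X j * of_nat (k - j) * pochhammer (d + of_nat j + 1) (k - j - 1)))"
    proof (rule sum.cong[OF refl])
      fix j assume "j \<in> {..k}"
      then obtain m where k: "k = j + m" by (auto simp: le_iff_add)
      let ?z = "d + of_nat j"
      have 1: "pochhammer (?z + 1) m * ?z = pochhammer ?z m * (?z + of_nat m)"
        using pochhammer_rec[of ?z m] pochhammer_rec'[of ?z m] by (simp add: mult_ac)
      have 2: "pochhammer (?z + 1) m = pochhammer ?z m + of_nat m * pochhammer (?z + 1) (m - 1)"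
        using pochhammer_shift_diff[of ?z] by (cases m) auto
      have "X j * pochhammer (?z + 1) m * (?bc + of_nat k * ?z)
         = X j * (?bc * pochhammer (?z + 1) m + of_nat k * (pochhammer (?z + 1) m * ?z))"
        by (simp add: algebra_simps)
      also have "\<dots> = X j * (?bc * (pochhammer ?z m + of_nat m * pochhammer (?z + 1) (m - 1))
          + of_nat k * (pochhammer ?z m * (?z + of_nat m)))"
        by (subst 1, subst 2) (rule refl)
      also have "?z + of_nat m = d + of_nat k" by (simp add: k)
      finally show "X j * pochhammer (?z + 1) (k - j) * (?bc + of_nat k * ?z)
        = (of_nat k * (d + of_nat k) + ?bc) * (X j * pochhammer ?z (k - j))
        + ?bc * (X j * of_nat (k - j) * pochhammer (?z + 1) (k - j - 1))"
        by (simp add: k algebra_simps)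
    qed
    also have "\<dots> = (of_nat k * (d + of_nat k) + ?bc) * S d k
        + ?bc * (\<Sum>j\<le>k. X j * of_nat (k - j) * pochhammer (d + of_nat j + 1) (k - j - 1))"
      unfolding S_def X_def sum.distrib sum_distrib_left by (simp add: mult_ac)
    \<comment> \<open>Absorption of \<open>k - j\<close> into the binomial coefficient, together
      with \<open>?e + 1 = (d + 1) - x - y\<close>, gives the sum for \<open>d + 1\<close> and
      \<open>k - 1\<close>. For \<open>k = 0\<close> both sides carry a zero factor.\<close>
    also have "(\<Sum>j\<le>k. X j * of_nat (k - j) * pochhammer (d + of_nat j + 1) (k - j - 1))
        = of_nat k * ?e * S (d + 1) (k - 1)"
    proof (cases k)
      case (Suc l)
      have "(\<Sum>j\<le>k. X j * of_nat (k - j) * pochhammer (d + of_nat j + 1) (k - j - 1))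
         = (\<Sum>j\<le>l. X j * of_nat (k - j) * pochhammer (d + of_nat j + 1) (k - j - 1))"
        unfolding Suc by simp
      also have "\<dots> = of_nat k * ?e * S (d + 1) l"
        unfolding S_def sum_distrib_left
      proof (rule sum.cong[OF refl])
        fix j assume "j \<in> {..l}"
        then have j: "j \<le> l" by simp
        have "(k choose j) * (k - j) = k * (l choose j)"
          using j Suc_times_binomial_eq[of l j] binomial_absorb_comp[of k j] Suc
          by (simp add: mult.commute)
        then have b: "of_nat (k choose j) * of_nat (k - j) = (of_nat k * of_nat (l choose j) :: 'a)"
          by (metis of_nat_mult)
        have e: "pochhammer ?e (k - j) = ?e * pochhammer (d + 1 - x - y) (l - j)"
          using j unfolding Suc by (simp add: Suc_diff_le pochhammer_rec algebra_simps)
        have "X j * of_nat (k - j) * pochhammer (d + of_nat j + 1) (k - j - 1)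
          = (of_nat (k choose j) * of_nat (k - j)) * (pochhammer x j * pochhammer y j
             * pochhammer (d + 1 + of_nat j) (l - j) * pochhammer ?e (k - j))"
          using j unfolding X_def Suc by (simp add: Suc_diff_le algebra_simps)
        also have "\<dots> = of_nat k * ?e * (of_nat (l choose j) * (pochhammer x j * pochhammer y j
             * pochhammer (d + 1 + of_nat j) (l - j) * pochhammer (d + 1 - x - y) (l - j)))"
          unfolding b e by (simp only: mult_ac)
        finally show "X j * of_nat (k - j) * pochhammer (d + of_nat j + 1) (k - j - 1) =
           of_nat k * ?e * (of_nat (l choose j) * (pochhammer x j * pochhammer y j
             * pochhammer (d + 1 + of_nat j) (l - j) * pochhammer (d + 1 - x - y) (l - j)))" .
      qed
      finally show ?thesis by (simp add: Suc)
    qed simp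
    finally show ?thesis by (simp only: mult_ac)
  qed
  \<comment> \<open>The second term of the recurrence is again a multiple of \<open>S d k\<close> by induction, since
    \<open>(d - x) (d - x + 1)\<^sub>k\<^sub>-\<^sub>1 = (d - x)\<^sub>k\<close>.\<close>
  have "S d k = pochhammer (d - x) k * pochhammer (d - y) k" for d
  proof (induction k arbitrary: d rule: less_induct)
    case (less k)
    show ?case
    proof (cases k)
      case 0
      then show ?thesis by (simp add: S_def)
    next
      case (Suc l)
      have IH1: "S d l = pochhammer (d - x) l * pochhammer (d - y) l"
        using less Suc by simp
      have IH2: "(d - x) * (d - y) * of_nat l * (d - x - y) * S (d + 1) (l - 1)
          = of_nat l * (d - x - y) * (pochhammer (d - x) l * pochhammer (d - y) l)"
      proof (cases l)
        case l: (Suc m)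
        have "S (d + 1) m = pochhammer (d - x + 1) m * pochhammer (d - y + 1) m"
          using less[of m "d + 1"] Suc l by (simp add: algebra_simps)
        then show ?thesis by (simp only: l pochhammer_rec mult_ac diff_Suc_1)
      qed simp
      show ?thesis
        unfolding Suc step IH1 IH2 by (simp add: pochhammer_rec' algebra_simps)
    qed
  qed
  then show ?thesis by (simp only: S_def)
qed

text \<open>The factors on the left are the negatives of those on the right, taken in reverse
  order.\<close>

lemma pochhammer_reflect:
  fixes z :: "'a :: comm_ring_1"
  shows "pochhammer (1 - of_nat m - z) m = (-1) ^ m * pochhammer z m"
  using pochhammer_minus[of "z + of_nat m - 1" m] by (simp add: algebra_simps)

text \<open>Expand \<open>(b)\<^sub>k (c)\<^sub>k\<close> by Pfaff--Saalschuetz, interchange the sums, and evaluate the inner sum by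
  Pfaff--Saalschuetz again.\<close>

lemma whipple_cleared:
  fixes a b c d e f :: "'a :: field_char_0"
  assumes bal: "d + e + f = 1 - of_nat n + a + b + c"
    and d: "pochhammer d n \<noteq> 0"
  shows "(\<Sum>k\<le>n. pochhammer (- of_nat n) k * pochhammer a k * pochhammer b k * pochhammer c k
            * pochhammer (e + of_nat k) (n - k) * pochhammer (f + of_nat k) (n - k) / (pochhammer d k * fact k))
       = (\<Sum>k\<le>n. pochhammer (- of_nat n) k * pochhammer a k * pochhammer (d - b) k * pochhammer (d - c) k
            * pochhammer (e - a) (n - k) * pochhammer (f - a) (n - k) / (pochhammer d k * fact k))"
proof -
  \<comment> \<open>For \<open>x = d - b\<close> and \<open>y = d - c\<close> one has
    \<open>d - x = b\<close>, \<open>d - y = c\<close> and \<open>d - x - y = B\<close>.\<close>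
  define B where "B = b + c - d"
  define g where "g j i = pochhammer (- of_nat n) (j + i) * pochhammer a (j + i)
      * (pochhammer (d - b) j * pochhammer (d - c) j * pochhammer B i)
      * pochhammer (e + of_nat (j + i)) (n - (j + i)) * pochhammer (f + of_nat (j + i)) (n - (j + i))
      / (pochhammer d j * fact j * fact i)" for j i
  have d0: "pochhammer d j \<noteq> 0" if "j \<le> n" for j
    using d pochhammer_product[OF that, of d] by auto
  have "(\<Sum>k\<le>n. pochhammer (- of_nat n) k * pochhammer a k * pochhammer b k * pochhammer c k
            * pochhammer (e + of_nat k) (n - k) * pochhammer (f + of_nat k) (n - k) / (pochhammer d k * fact k))
      = (\<Sum>k\<le>n. \<Sum>j\<le>k. g j (k - j))"
  proof (rule sum.cong[OF refl])
    fix k assume k: "k \<in> {..n}"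
    have "pochhammer b k * pochhammer c k
       = (\<Sum>j\<le>k. of_nat (k choose j) * (pochhammer (d - b) j * pochhammer (d - c) j
             * pochhammer (d + of_nat j) (k - j) * pochhammer B (k - j)))"
      using pfaff_saalschuetz[of k "d - b" "d - c" d] by (simp add: B_def algebra_simps)
    then have "pochhammer b k * pochhammer c k / (pochhammer d k * fact k)
       = (\<Sum>j\<le>k. of_nat (k choose j) * (pochhammer (d - b) j * pochhammer (d - c) j
             * pochhammer (d + of_nat j) (k - j) * pochhammer B (k - j)) / (pochhammer d k * fact k))"
      by (simp only: sum_divide_distrib)
    also have "\<dots> = (\<Sum>j\<le>k. pochhammer (d - b) j * pochhammer (d - c) j * pochhammer B (k - j)
           / (pochhammer d j * fact j * fact (k - j)))"
    proof (rule sum.cong[OF refl])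
      fix j assume "j \<in> {..k}"
      then have j: "j \<le> k" by simp
      have "pochhammer d k = pochhammer d j * pochhammer (d + of_nat j) (k - j)"
        by (rule pochhammer_product[OF j])
      moreover have "pochhammer d k \<noteq> 0" using d0 k by simp
      ultimately show "of_nat (k choose j) * (pochhammer (d - b) j * pochhammer (d - c) j
             * pochhammer (d + of_nat j) (k - j) * pochhammer B (k - j)) / (pochhammer d k * fact k)
          = pochhammer (d - b) j * pochhammer (d - c) j * pochhammer B (k - j)
           / (pochhammer d j * fact j * fact (k - j))"
        unfolding binomial_fact[OF j] by (simp add: field_simps)
    qed
    finally have *: "pochhammer b k * pochhammer c k / (pochhammer d k * fact k) = \<dots>" .
    have "pochhammer (- of_nat n) k * pochhammer a k * pochhammer b k * pochhammer c k
            * pochhammer (e + of_nat k) (n - k) * pochhammer (f + of_nat k) (n - k) / (pochhammer d k * fact k)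
        = pochhammer (- of_nat n) k * pochhammer a k * pochhammer (e + of_nat k) (n - k)
            * pochhammer (f + of_nat k) (n - k) * (pochhammer b k * pochhammer c k / (pochhammer d k * fact k))"
      by simp
    also have "\<dots> = (\<Sum>j\<le>k. g j (k - j))"
      unfolding * sum_distrib_left by (rule sum.cong) (auto simp: g_def)
    finally show "pochhammer (- of_nat n) k * pochhammer a k * pochhammer b k * pochhammer c k
            * pochhammer (e + of_nat k) (n - k) * pochhammer (f + of_nat k) (n - k) / (pochhammer d k * fact k)
        = (\<Sum>j\<le>k. g j (k - j))" .
  qed
  also have "\<dots> = (\<Sum>j\<le>n. \<Sum>i\<le>n - j. g j i)"
    unfolding sum.triangle_reindex_eq[symmetric]
    by (subst sum.Sigma) (auto intro!: sum.cong)
  also have "\<dots> = (\<Sum>k\<le>n. pochhammer (- of_nat n) k * pochhammer a k * pochhammer (d - b) k * pochhammer (d - c) k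
            * pochhammer (e - a) (n - k) * pochhammer (f - a) (n - k) / (pochhammer d k * fact k))"
  proof (rule sum.cong[OF refl])
    fix j assume "j \<in> {..n}"
    then have j: "j \<le> n" by simp
    define N where "N = n - j"
    have n: "of_nat n = (of_nat j + of_nat N :: 'a)" using j by (simp add: N_def of_nat_diff)
    let ?x = "a + of_nat j" and ?D = "e + of_nat j"
    have sq: "(-1 :: 'a) ^ N * (-1) ^ N = 1" for N
      by (simp flip: power_mult_distrib)
    have "(\<Sum>i\<le>N. of_nat (N choose i) * (pochhammer ?x i * pochhammer B i * pochhammer (?D + of_nat i) (N - i)
             * ((-1) ^ (N - i) * pochhammer (f + of_nat (j + i)) (N - i))))
        = (\<Sum>i\<le>N. of_nat (N choose i) * (pochhammer ?x i * pochhammer B i * pochhammer (?D + of_nat i) (N - i)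
             * pochhammer (?D - ?x - B) (N - i)))"
    proof (rule sum.cong[OF refl])
      fix i assume i: "i \<in> {..N}"
      \<comment> \<open>The balancing condition enters here: it makes the reflected
        \<open>f\<close>-symbol the one that Pfaff--Saalschuetz requires for \<open>?x\<close>,
        \<open>B\<close> and \<open>?D\<close>.\<close>
      have "?D - ?x - B = 1 - of_nat (N - i) - (f + of_nat (j + i))"
        using bal i n by (simp add: B_def of_nat_diff algebra_simps)
      then show "of_nat (N choose i) * (pochhammer ?x i * pochhammer B i * pochhammer (?D + of_nat i) (N - i)
             * ((-1) ^ (N - i) * pochhammer (f + of_nat (j + i)) (N - i)))
          = of_nat (N choose i) * (pochhammer ?x i * pochhammer B i * pochhammer (?D + of_nat i) (N - i)
             * pochhammer (?D - ?x - B) (N - i))"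
        by (simp only: pochhammer_reflect)
    qed
    also have "\<dots> = pochhammer (?D - ?x) N * pochhammer (?D - B) N"
      by (rule pfaff_saalschuetz)
    also have "?D - ?x = e - a" by simp
    also have "?D - B = 1 - of_nat N - (f - a)"
      using bal n by (simp add: B_def algebra_simps)
    finally have S: "(\<Sum>i\<le>N. of_nat (N choose i) * (pochhammer ?x i * pochhammer B i
          * pochhammer (?D + of_nat i) (N - i) * ((-1) ^ (N - i) * pochhammer (f + of_nat (j + i)) (N - i))))
        = pochhammer (e - a) N * ((-1) ^ N * pochhammer (f - a) N)"
      by (simp only: pochhammer_reflect)
    \<comment> \<open>The sign \<open>(-1) ^ i\<close> comes from
      \<open>pochhammer (- N) i / fact i\<close>. Split as \<open>(-1) ^ N * (-1) ^ (N - i)\<close>,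
      it leaves a constant in front of the sum over \<open>i\<close> and the sign that reflects the
      \<open>f\<close>-symbol.\<close>
    have g: "g j i = pochhammer (- of_nat n) j * pochhammer a j * pochhammer (d - b) j * pochhammer (d - c) j
         / (pochhammer d j * fact j) * ((-1) ^ N * (of_nat (N choose i) * (pochhammer ?x i * pochhammer B i
          * pochhammer (?D + of_nat i) (N - i) * ((-1) ^ (N - i) * pochhammer (f + of_nat (j + i)) (N - i)))))"
      if "i \<le> N" for i
    proof -
      have "pochhammer (- of_nat n :: 'a) (j + i) = pochhammer (- of_nat n) j * pochhammer (- of_nat N) i"
        unfolding pochhammer_product' by (simp add: n)
      moreover have "pochhammer (- of_nat N :: 'a) i / fact i = (-1) ^ i * of_nat (N choose i)"
        by (simp add: gbinomial_pochhammer binomial_gbinomial field_simps sq flip: mult.assoc)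
      ultimately have 1: "pochhammer (- of_nat n :: 'a) (j + i) / fact i
          = pochhammer (- of_nat n) j * ((-1) ^ i * of_nat (N choose i))"
        by (metis times_divide_eq_right)
      have 2: "pochhammer a (j + i) = pochhammer a j * pochhammer ?x i"
        by (rule pochhammer_product')
      have 3: "(-1 :: 'a) ^ i = (-1) ^ N * (-1) ^ (N - i)"
      proof -
        have "(-1 :: 'a) ^ N = (-1) ^ i * (-1) ^ (N - i)"
          using that by (simp flip: power_add)
        then show ?thesis using sq[of "N - i"] by (simp add: mult.assoc)
      qed
      have 4: "n - (j + i) = N - i" by (simp add: N_def)
      have 5: "e + of_nat (j + i) = ?D + of_nat i" by simp
      have "g j i = (pochhammer (- of_nat n) (j + i) / fact i) * pochhammer a (j + i)
          * (pochhammer (d - b) j * pochhammer (d - c) j * pochhammer B i)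
          * pochhammer (?D + of_nat i) (N - i) * pochhammer (f + of_nat (j + i)) (N - i)
          / (pochhammer d j * fact j)"
        unfolding g_def 4 5 by simp
      then show ?thesis unfolding 1 2 3 by simp
    qed
    have "(\<Sum>i\<le>N. g j i) = pochhammer (- of_nat n) j * pochhammer a j * pochhammer (d - b) j * pochhammer (d - c) j
         / (pochhammer d j * fact j) * ((-1) ^ N * (\<Sum>i\<le>N. of_nat (N choose i) * (pochhammer ?x i * pochhammer B i
          * pochhammer (?D + of_nat i) (N - i) * ((-1) ^ (N - i) * pochhammer (f + of_nat (j + i)) (N - i)))))"
      unfolding sum_distrib_left by (rule sum.cong[OF refl], rule g) simp
    also have "\<dots> = pochhammer (- of_nat n) j * pochhammer a j * pochhammer (d - b) j * pochhammer (d - c) j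
         / (pochhammer d j * fact j) * (((-1) ^ N * (-1) ^ N) * (pochhammer (e - a) N * pochhammer (f - a) N))"
      unfolding S by (simp only: mult_ac)
    finally show "(\<Sum>i\<le>n - j. g j i) = pochhammer (- of_nat n) j * pochhammer a j * pochhammer (d - b) j
            * pochhammer (d - c) j * pochhammer (e - a) (n - j) * pochhammer (f - a) (n - j) / (pochhammer d j * fact j)"
      unfolding sq N_def by simp
  qed
  finally show ?thesis .
qed

text \<open>The cleared identity is divided by \<open>pochhammer e n * pochhammer f n\<close>, and
  the symbols of length \<open>n - k\<close> are reversed into quotients by symbols of length
  \<open>k\<close>. The two reversals contribute the same sign, which cancels.\<close>

theorem whipple_transformation:
  fixes a b c d e f :: "'a :: field_char_0"
  assumes bal: "d + e + f = 1 - of_nat n + a + b + c"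
    and d: "pochhammer d n \<noteq> 0" and e: "pochhammer e n \<noteq> 0" and f: "pochhammer f n \<noteq> 0"
    and e': "pochhammer (1 - of_nat n - (e - a)) n \<noteq> 0" and f': "pochhammer (1 - of_nat n - (f - a)) n \<noteq> 0"
  shows "(\<Sum>k\<le>n. pochhammer (- of_nat n) k * pochhammer a k * pochhammer b k * pochhammer c k
            / (pochhammer d k * pochhammer e k * pochhammer f k * fact k))
       = pochhammer (e - a) n * pochhammer (f - a) n / (pochhammer e n * pochhammer f n)
         * (\<Sum>k\<le>n. pochhammer (- of_nat n) k * pochhammer a k * pochhammer (d - b) k * pochhammer (d - c) k
            / (pochhammer d k * pochhammer (1 - of_nat n - (e - a)) k * pochhammer (1 - of_nat n - (f - a)) k * fact k))"
    (is "?L = ?G * ?R")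
proof -
  have "?L * (pochhammer e n * pochhammer f n)
      = (\<Sum>k\<le>n. pochhammer (- of_nat n) k * pochhammer a k * pochhammer b k * pochhammer c k
            * pochhammer (e + of_nat k) (n - k) * pochhammer (f + of_nat k) (n - k) / (pochhammer d k * fact k))"
    unfolding sum_distrib_right
  proof (rule sum.cong[OF refl])
    fix k assume "k \<in> {..n}"
    then have "k \<le> n" by simp
    note pp = this[THEN pochhammer_product]
    show "pochhammer (- of_nat n) k * pochhammer a k * pochhammer b k * pochhammer c k
            / (pochhammer d k * pochhammer e k * pochhammer f k * fact k) * (pochhammer e n * pochhammer f n)
        = pochhammer (- of_nat n) k * pochhammer a k * pochhammer b k * pochhammer c k
            * pochhammer (e + of_nat k) (n - k) * pochhammer (f + of_nat k) (n - k) / (pochhammer d k * fact k)"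
      using e f unfolding pp[of e] pp[of f] by (simp add: field_simps)
  qed
  also have "\<dots> = (\<Sum>k\<le>n. pochhammer (- of_nat n) k * pochhammer a k * pochhammer (d - b) k * pochhammer (d - c) k
            * pochhammer (e - a) (n - k) * pochhammer (f - a) (n - k) / (pochhammer d k * fact k))"
    by (rule whipple_cleared[OF bal d])
  also have "\<dots> = pochhammer (e - a) n * pochhammer (f - a) n * ?R"
    unfolding sum_distrib_left
  proof (rule sum.cong[OF refl])
    fix k assume "k \<in> {..n}"
    then have k: "k \<le> n" by simp
    have rev: "pochhammer z (n - k) = (-1) ^ k * pochhammer z n / pochhammer (1 - of_nat n - z) k"
      if "pochhammer (1 - of_nat n - z) n \<noteq> 0" for z :: 'a
    proof -
      have "pochhammer z n = pochhammer z (n - k) * pochhammer (z + of_nat (n - k)) k"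
        using pochhammer_product[of "n - k" n z] k by simp
      moreover have "pochhammer (1 - of_nat n - z) k = (-1) ^ k * pochhammer (z + of_nat (n - k)) k"
        using pochhammer_reflect[of k "z + of_nat (n - k)"] k by (simp add: of_nat_diff algebra_simps)
      moreover have "pochhammer (1 - of_nat n - z) k \<noteq> 0"
        using that pochhammer_product[OF k, of "1 - of_nat n - z"] by auto
      moreover have "(-1 :: 'a) ^ k \<noteq> 0" by simp
      ultimately show ?thesis by (simp add: field_simps)
    qed
    have sq: "(-1 :: 'a) ^ k * (-1) ^ k = 1"
      by (simp flip: power_mult_distrib)
    let ?T = "pochhammer (- of_nat n) k * pochhammer a k * pochhammer (d - b) k * pochhammer (d - c) k"
    let ?E = "pochhammer (1 - of_nat n - (e - a)) k" and ?F = "pochhammer (1 - of_nat n - (f - a)) k"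
    have "?T * pochhammer (e - a) (n - k) * pochhammer (f - a) (n - k) / (pochhammer d k * fact k)
        = ((-1) ^ k * (-1) ^ k) * (pochhammer (e - a) n * pochhammer (f - a) n * (?T / (pochhammer d k * ?E * ?F * fact k)))"
      unfolding rev[OF e'] rev[OF f'] by (simp only: times_divide_eq_left times_divide_eq_right divide_divide_eq_left mult_ac)
    then show "?T * pochhammer (e - a) (n - k) * pochhammer (f - a) (n - k) / (pochhammer d k * fact k)
        = pochhammer (e - a) n * pochhammer (f - a) n * (?T / (pochhammer d k * ?E * ?F * fact k))"
      unfolding sq by simp
  qed
  finally show ?thesis using e f by (simp add: field_simps)
qed

section \<open>Morita's products over the integers\<close>

text \<open>Wilson's theorem for prime powers. The unit group is cyclic of even order
  \<open>t\<close>; for a generator \<open>g\<close> the product is \<open>g\<close> to the power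
  \<open>0 + ... + (t - 1)\<close>, that is \<open>h ^ (t - 1)\<close> with
  \<open>h = g ^ (t div 2)\<close>. Here \<open>h\<close> is a square root of \<open>1\<close> other
  than \<open>1\<close>, hence \<open>-1\<close>, and \<open>t - 1\<close> is odd.\<close>

theorem prod_totatives_odd_prime_power:
  assumes p: "prime p" "odd p" and k: "k > 0"
  shows "[int (\<Prod>(totatives (p ^ k))) = -1] (mod int p ^ k)"
proof -
  define m where "m = p ^ k"
  define t where "t = totient m"
  from residue_primroot_odd_prime_power_exists[OF p] k obtain g where g: "residue_primroot m g"
    unfolding m_def by blast
  have "p > 2" using p prime_ge_2_nat[of p] by (cases "p = 2") auto
  also have "p \<le> m" unfolding m_def using k \<open>p > 2\<close> by (intro self_le_power) auto
  finally have m: "m > 2" .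
  then have "even t" "t > 0" unfolding t_def by (auto intro: totient_even)
  define h where "h = g ^ (t div 2)"
  have ord: "ord m g = t" using g by (simp add: residue_primroot_def t_def)
  have "h ^ 2 = g ^ t" unfolding h_def using \<open>even t\<close> by (simp flip: power_mult)
  then have "[h ^ 2 = 1] (mod m)" using ord ord_divides[of g t m] by simp
  then have "[int h ^ 2 = 1] (mod int m)" by (metis cong_int_iff of_nat_1 of_nat_power)
  moreover have "int h ^ 2 - 1 = (int h - 1) * (int h + 1)"
    by (simp add: power2_eq_square algebra_simps)
  ultimately have dvd: "int m dvd (int h - 1) * (int h + 1)"
    by (simp add: cong_iff_dvd_diff)
  have ne: "\<not> int m dvd int h - 1"
  proof
    assume "int m dvd int h - 1"
    then have "[int h = int 1] (mod int m)" by (simp add: cong_iff_dvd_diff)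
    then have "[g ^ (t div 2) = 1] (mod m)" unfolding h_def by (simp only: cong_int_iff)
    moreover have "0 < t div 2" "t div 2 < ord m g"
      using \<open>even t\<close> \<open>t > 0\<close> ord by (auto elim!: evenE)
    ultimately show False using ord_minimal by blast
  qed
  have pint: "prime (int p)" using p by simp
  \<comment> \<open>An odd prime cannot divide both \<open>h - 1\<close> and \<open>h + 1\<close>,
    so the whole of \<open>m\<close> divides one of them.\<close>
  have "int p dvd int h - 1 \<Longrightarrow> \<not> int p dvd int h + 1"
  proof
    assume a: "int p dvd int h - 1" "int p dvd int h + 1"
    have "int p dvd (int h + 1) - (int h - 1)" by (rule dvd_diff[OF a(2,1)])
    then have "int p dvd 2" by simp
    then show False using \<open>p > 2\<close> by (auto dest: zdvd_imp_le)
  qed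
  moreover have cop: "coprime (int m) x" if "\<not> int p dvd x" for x
    unfolding m_def using that prime_imp_coprime[OF pint] by simp
  ultimately have "int m dvd int h + 1"
    using dvd ne by (metis coprime_dvd_mult_left_iff coprime_dvd_mult_right_iff)
  then have h: "[int h = -1] (mod int m)" by (simp add: cong_iff_dvd_diff)
  have "\<Prod>(totatives m) = (\<Prod>i<t. g ^ i mod m)"
    using residue_primroot_is_generator[of m g] m g
    unfolding t_def by (simp add: prod.reindex_bij_betw[of _ _ _ "\<lambda>x. x"])
  moreover have "[(\<Prod>i<t. g ^ i mod m) = (\<Prod>i<t. g ^ i)] (mod m)"
    by (rule cong_prod) (simp add: cong_def)
  moreover have "(\<Prod>i<t. g ^ i) = h ^ (t - 1)"
  proof -
    have "(\<Prod>i<t. g ^ i) = g ^ (\<Sum>i<t. i)" by (simp add: power_sum)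
    also have "(\<Sum>i<t. i) = t div 2 * (t - 1)"
      using \<open>even t\<close> \<open>t > 0\<close> Sum_Ico_nat[of 0 t] by (auto simp: atLeast0LessThan elim!: evenE)
    finally show ?thesis by (simp add: h_def power_mult)
  qed
  ultimately have "[\<Prod>(totatives m) = h ^ (t - 1)] (mod m)" by simp
  then have "[int (\<Prod>(totatives m)) = int h ^ (t - 1)] (mod int m)"
    by (metis cong_int_iff of_nat_power)
  also have "[int h ^ (t - 1) = (-1) ^ (t - 1)] (mod int m)" by (rule cong_pow[OF h])
  also have "(-1) ^ (t - 1) = (-1 :: int)"
    using \<open>even t\<close> \<open>t > 0\<close> by simp
  finally show ?thesis by (simp add: m_def)
qed

text \<open>Morita's values at the natural numbers, kept as integers so that congruences apply; the
  empty product gives the prescribed value at \<open>0\<close>.\<close>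

definition morita :: "nat \<Rightarrow> nat \<Rightarrow> int" where
  "morita p n = (-1) ^ n * int (\<Prod>j | 1 \<le> j \<and> j < n \<and> \<not> p dvd j. j)"

lemma morita_0 [simp]: "morita p 0 = 1"
  by (simp add: morita_def)

lemma morita_Suc: "morita p (Suc n) = (if p dvd n then - 1 else - int n) * morita p n"
proof (cases "p dvd n")
  case True
  then have "{j. 1 \<le> j \<and> j < Suc n \<and> \<not> p dvd j} = {j. 1 \<le> j \<and> j < n \<and> \<not> p dvd j}"
    by (auto simp: less_Suc_eq)
  then show ?thesis using True by (simp add: morita_def)
next
  case False
  then have "n > 0" by (intro Nat.gr0I) auto
  then have "{j. 1 \<le> j \<and> j < Suc n \<and> \<not> p dvd j} = insert n {j. 1 \<le> j \<and> j < n \<and> \<not> p dvd j}"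
    using False by auto
  then show ?thesis using False by (simp add: morita_def)
qed

text \<open>Induction on \<open>n\<close>: the factors of the functional equation at
  \<open>n\<close> and \<open>n + p ^ k\<close> agree modulo \<open>p ^ k\<close>. The base case is
  Wilson's theorem for prime powers, whose \<open>-1\<close> cancels against
  \<open>(-1) ^ (p ^ k)\<close>.\<close>

lemma morita_add_power:
  assumes p: "prime p" "odd p"
  shows "[morita p (n + p ^ k) = morita p n] (mod int p ^ k)"
proof (cases "k = 0")
  case k: False
  show ?thesis
  proof (induction n)
    case 0
    have "coprime p j \<longleftrightarrow> \<not> p dvd j" for j
      using prime_imp_coprime[OF p(1), of j] coprime_absorb_left[of p j] p(1) by auto
    then have cop: "coprime j (p ^ k) \<longleftrightarrow> \<not> p dvd j" for j
      using k by (simp add: coprime_commute)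
    have pk: "p dvd p ^ k" using k by simp
    have "{j. 1 \<le> j \<and> j < p ^ k \<and> \<not> p dvd j} = {j. 0 < j \<and> j \<le> p ^ k \<and> \<not> p dvd j}"
      using pk by (metis (no_types, lifting) One_nat_def Suc_le_eq order_le_less)
    also have "\<dots> = totatives (p ^ k)"
      unfolding totatives_def cop by auto
    finally have "{j. 1 \<le> j \<and> j < p ^ k \<and> \<not> p dvd j} = totatives (p ^ k)" .
    then have "morita p (p ^ k) = - int (\<Prod>(totatives (p ^ k)))"
      using p by (simp add: morita_def)
    also have "[\<dots> = - (- 1)] (mod int p ^ k)"
      using prod_totatives_odd_prime_power[OF p] k by (intro cong_minus_minus_iff[THEN iffD2]) simp
    finally show ?case by simp
  next
    case (Suc n)
    have "p dvd n + p ^ k \<longleftrightarrow> p dvd n"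
      using k by (intro dvd_add_left_iff) simp
    moreover have "[- int (n + p ^ k) = - int n] (mod int p ^ k)"
      by (simp add: cong_iff_dvd_diff)
    ultimately have "[(if p dvd n + p ^ k then - 1 else - int (n + p ^ k)) = (if p dvd n then - 1 else - int n)]
        (mod int p ^ k)" by simp
    from cong_mult[OF this Suc] show ?case by (simp only: morita_Suc add_Suc)
  qed
qed simp

text \<open>The p-adic continuity of Morita's values, obtained by iterating the period
  \<open>p ^ k\<close>.\<close>

lemma morita_cong:
  assumes p: "prime p" "odd p" and "[m = n] (mod p ^ k)"
  shows "[morita p m = morita p n] (mod int p ^ k)"
proof -
  have *: "[morita p (n + p ^ k * t) = morita p n] (mod int p ^ k)" for n t
  proof (induction t)
    case (Suc t)
    then show ?case
      using morita_add_power[OF p, of "n + p ^ k * t" k] by (auto simp: algebra_simps intro: cong_trans)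
  qed simp
  have "[morita p m = morita p (m mod p ^ k)] (mod int p ^ k)" for m
    using *[of "m mod p ^ k" "m div p ^ k"] by simp
  from this[of m] this[of n] assms(3) show ?thesis
    by (metis cong_def)
qed

lemma prod_shift_cong_fact:
  assumes p: "prime p" "odd p"
  shows "[(\<Prod>j\<in>{1..<p}. int (p * m + j)) = fact (p - 1)] (mod int p ^ 2)"
proof -
  have pint: "prime (int p)" using p by simp
  define A where "A m = (\<Prod>j\<in>{1..<p}. int (p * m + j))" for m
  have A0: "A 0 = fact (p - 1)"
    using prime_gt_0_nat[OF p(1)] unfolding A_def fact_prod
    by (simp add: atLeastLessThanSuc_atLeastAtMost[symmetric])
  \<comment> \<open>Pairing \<open>j\<close> with \<open>p - j\<close> makes the terms linear in \<open>m\<close> cancel modulo \<open>p\<^sup>2\<close>.\<close>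
  have sq: "[A m * A m = (\<Prod>j\<in>{1..<p}. int j * int (p - j))] (mod int p ^ 2)" for m
  proof -
    have "A m = (\<Prod>j\<in>{1..<p}. int (p * m + (p - j)))"
      unfolding A_def by (rule prod.reindex_bij_witness[of _ "\<lambda>j. p - j" "\<lambda>j. p - j"]) auto
    then have "A m * A m = (\<Prod>j\<in>{1..<p}. int (p * m + j) * int (p * m + (p - j)))"
      unfolding prod.distrib by (simp add: A_def)
    also have "[\<dots> = (\<Prod>j\<in>{1..<p}. int j * int (p - j))] (mod int p ^ 2)"
    proof (rule cong_prod)
      fix j assume "j \<in> {1..<p}"
      then have "int (p * m + j) * int (p * m + (p - j)) - int j * int (p - j)
          = int p ^ 2 * (int m * int m + int m)"
        by (simp add: of_nat_diff power2_eq_square algebra_simps)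
      then show "[int (p * m + j) * int (p * m + (p - j)) = int j * int (p - j)] (mod int p ^ 2)"
        by (simp add: cong_iff_dvd_diff)
    qed
    finally show ?thesis .
  qed
  have "[A m * A m = A 0 * A 0] (mod int p ^ 2)"
    using cong_trans[OF sq[of m] cong_sym[OF sq[of 0]]] .
  then have "int p ^ 2 dvd (A m + A 0) * (A m - A 0)"
    by (simp add: cong_iff_dvd_diff algebra_simps)
  \<comment> \<open>Equal squares leave a choice of sign. Modulo \<open>p\<close> the sum is
    \<open>2 * fact (p - 1)\<close>, a unit for odd \<open>p\<close>, so the difference carries all
    of \<open>p ^ 2\<close>.\<close>
  moreover have "coprime (int p ^ 2) (A m + A 0)"
  proof -
    have "[A m = A 0] (mod int p)"
      unfolding A_def by (rule cong_prod) (simp add: cong_def)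
    then have "[A m + A 0 = 2 * A 0] (mod int p)"
      using cong_add[of "A m" "A 0" "int p" "A 0" "A 0"] by simp
    moreover have "\<not> int p dvd 2 * A 0"
    proof
      assume "int p dvd 2 * A 0"
      then have "int p dvd 2 \<or> int p dvd A 0" using pint by (simp add: prime_dvd_mult_iff)
      then show False
      proof
        assume "int p dvd 2"
        then have "p \<le> 2" by (auto dest: zdvd_imp_le)
        then show False using p prime_ge_2_nat[of p] by auto
      next
        assume "int p dvd A 0"
        then have "p dvd fact (p - 1)"
          unfolding A0 by (metis int_dvd_int_iff of_nat_fact)
        then show False
          using p prime_dvd_fact_iff[of p "p - 1"] prime_gt_0_nat[of p] by simp
      qed
    qed
    ultimately have "\<not> int p dvd A m + A 0"
      by (metis cong_dvd_iff)
    then show ?thesis using prime_imp_coprime[OF pint] by simp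
  qed
  ultimately have "int p ^ 2 dvd A m - A 0"
    by (simp add: coprime_dvd_mult_right_iff)
  then show ?thesis using A0 by (simp add: cong_iff_dvd_diff A_def)
qed

text \<open>Passing from \<open>p * m\<close> to \<open>p * Suc m\<close> multiplies by
  \<open>- fact (p - 1)\<close> modulo \<open>p ^ 2\<close>, which Wilson's theorem writes as
  \<open>1 + p * c\<close> with \<open>c\<close> minus the Wilson quotient. Powers of
  \<open>1 + p * c\<close> are linear in the exponent modulo \<open>p ^ 2\<close>.\<close>

lemma morita_prime_mult:
  assumes p: "prime p" "odd p"
  obtains c where "\<And>m. [morita p (p * m) = 1 + int p * int m * c] (mod int p ^ 2)"
proof -
  have "[fact (p - 1) = (- 1 :: int)] (mod int p)"
    using p by (intro wilson_theorem)
  then obtain d where "fact (p - 1) + 1 = int p * d"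
    by (auto simp: cong_iff_dvd_diff)
  then have c: "- fact (p - 1) = 1 + int p * (- d)" by simp
  define c where "c = - d"
  note c = c[folded c_def]
  have step: "[morita p (p * Suc m) = (1 + int p * c) * morita p (p * m)] (mod int p ^ 2)" for m
  proof -
    \<comment> \<open>Leaving \<open>p * m\<close> costs only the factor \<open>-1\<close>, because
      \<open>p\<close> divides it; hence \<open>Suc i\<close> signs but \<open>i\<close> integer
      factors.\<close>
    have prods: "i < p \<Longrightarrow> morita p (Suc (p * m + i)) = (-1) ^ Suc i * (\<Prod>j<i. int (p * m + Suc j)) * morita p (p * m)" for i
    proof (induction i)
      case (Suc i)
      then have "\<not> p dvd p * m + Suc i"
        by (metis dvd_add_right_iff dvd_triv_left nat_dvd_not_less zero_less_Suc)
      then have "morita p (Suc (p * m + Suc i)) = - int (p * m + Suc i) * morita p (Suc (p * m + i))"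
        using morita_Suc[of p "p * m + Suc i"] by simp
      then show ?case using Suc by (simp add: algebra_simps del: of_nat_add)
    qed (simp add: morita_Suc)
    have "(\<Prod>j<p - 1. int (p * m + Suc j)) = (\<Prod>j\<in>{1..<p}. int (p * m + j))"
      by (rule prod.reindex_bij_witness[of _ "\<lambda>j. j - 1" Suc]) auto
    with prods[of "p - 1"] have "p - 1 < p \<Longrightarrow> morita p (Suc (p * m + (p - 1)))
        = (-1) ^ Suc (p - 1) * (\<Prod>j\<in>{1..<p}. int (p * m + j)) * morita p (p * m)"
      by (simp only:)
    then have "morita p (Suc (p * m + (p - 1)))
        = (-1) ^ Suc (p - 1) * (\<Prod>j\<in>{1..<p}. int (p * m + j)) * morita p (p * m)"
      using prime_gt_0_nat[OF p(1)] by (simp only: diff_less zero_less_one)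
    moreover have "Suc (p * m + (p - 1)) = p * Suc m" "Suc (p - 1) = p"
      using prime_gt_0_nat[OF p(1)] by simp_all
    moreover have "(-1) ^ p = (-1 :: int)" using p(2) by simp
    ultimately have "morita p (p * Suc m) = - (\<Prod>j\<in>{1..<p}. int (p * m + j)) * morita p (p * m)"
      by (simp only: mult_minus_left mult_1_left)
    also have "[\<dots> = - fact (p - 1) * morita p (p * m)] (mod int p ^ 2)"
      by (intro cong_mult cong_refl cong_minus_minus_iff[THEN iffD2] prod_shift_cong_fact[OF p])
    finally show ?thesis by (simp only: c)
  qed
  have "[morita p (p * m) = 1 + int p * int m * c] (mod int p ^ 2)" for m
  proof (induction m)
    case (Suc m)
    have "[morita p (p * Suc m) = (1 + int p * c) * (1 + int p * int m * c)] (mod int p ^ 2)"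
      using cong_trans[OF step cong_mult[OF cong_refl Suc]] .
    also have "(1 + int p * c) * (1 + int p * int m * c) - (1 + int p * int (Suc m) * c) = int p ^ 2 * (int m * c * c)"
      by (simp add: power2_eq_square algebra_simps)
    then have "[(1 + int p * c) * (1 + int p * int m * c) = 1 + int p * int (Suc m) * c] (mod int p ^ 2)"
      by (simp add: cong_iff_dvd_diff)
    finally show ?case .
  qed simp
  then show ?thesis using that by blast
qed

section \<open>The p-adic gamma function\<close>

abbreviation pp :: "'p :: prime_card padic_int" where
  "pp \<equiv> of_nat CARD('p)"

lemma padic_power_dvd_diff_iff:
  fixes x y :: "'p :: prime_card padic_int"
  shows "pp ^ n dvd x - y \<longleftrightarrow> padic_approx x n = padic_approx y n"
proof -
  have "pp ^ n dvd x - y \<longleftrightarrow> [padic_approx x n = padic_approx y n] (mod int CARD('p) ^ n)"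
    by (simp add: padic_power_dvd_iff padic_approx_diff cong_iff_dvd_diff dvd_eq_mod_eq_0)
  also have "\<dots> \<longleftrightarrow> padic_approx x n = padic_approx y n"
    using padic_approx_range[of x n] padic_approx_range[of y n] by (simp add: cong_def)
  finally show ?thesis .
qed

lemma padic_int_eq_if_dvd:
  fixes x y :: "'p :: prime_card padic_int"
  assumes "\<And>k. pp ^ k dvd x - y"
  shows "x = y"
  using assms by (intro padic_int_eqI) (simp add: padic_power_dvd_diff_iff)

lemma padic_approx_of_int:
  "padic_approx (of_int m :: 'p :: prime_card padic_int) n = m mod int CARD('p) ^ n"
proof (cases m rule: int_cases2)
  case (nonpos k)
  then show ?thesis
    using padic_approx_diff[of "0 :: 'p padic_int" "of_nat k" n] by (simp add: padic_approx_of_nat mod_simps)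
qed (simp add: padic_approx_of_nat)

lemma padic_approx_1: "padic_approx (1 :: 'p :: prime_card padic_int) n = 1 mod int CARD('p) ^ n"
  using padic_approx_of_int[where 'p = 'p, of 1] by simp

lemma padic_power_dvd_of_int_iff:
  "(pp :: 'p :: prime_card padic_int) ^ n dvd of_int m \<longleftrightarrow> int CARD('p) ^ n dvd m"
  by (simp add: padic_power_dvd_iff padic_approx_of_int dvd_eq_mod_eq_0)

lemma padic_dvd_of_nat_iff:
  "(pp :: 'p :: prime_card padic_int) dvd of_nat m \<longleftrightarrow> CARD('p) dvd m"
  using padic_power_dvd_of_int_iff[where 'p = 'p, of 1 "int m"] by simp

lemma padic_nat_approx:
  fixes x :: "'p :: prime_card padic_int"
  obtains n where "pp ^ k dvd x - of_nat n" "n < CARD('p) ^ k" "padic_approx x k = int n"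
proof
  let ?n = "nat (padic_approx x k)"
  show n: "padic_approx x k = int ?n" using padic_approx_range(1)[of x k] by simp
  show "pp ^ k dvd x - of_nat ?n"
    using padic_approx_range[of x k] by (simp add: padic_power_dvd_diff_iff padic_approx_of_int)
  show "?n < CARD('p) ^ k"
    using padic_approx_range(2)[of x k] n by (metis of_nat_less_iff of_nat_power)
qed

lemma prime_elem_pp: "prime_elem (pp :: 'p :: prime_card padic_int)"
proof (rule prime_elemI)
  show "(pp :: 'p padic_int) \<noteq> 0" using prime_gt_0_nat[OF prime_card[where 'a = 'p]] by simp
  show "\<not> (pp :: 'p padic_int) dvd 1"
    using padic_dvd_of_nat_iff[where 'p = 'p, of 1] prime_gt_1_nat[OF prime_card[where 'a = 'p]] by simp
  fix x y :: "'p padic_int"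
  assume "pp dvd x * y"
  then have "int CARD('p) dvd padic_approx x 1 * padic_approx y 1"
    using padic_power_dvd_iff[of 1 "x * y"] by (auto simp: padic_approx_mult)
  moreover have "prime (int CARD('p))" using prime_card[where 'a = 'p] by simp
  ultimately have "int CARD('p) dvd padic_approx x 1 \<or> int CARD('p) dvd padic_approx y 1"
    by (simp add: prime_dvd_mult_iff)
  then show "pp dvd x \<or> pp dvd y"
    using padic_power_dvd_iff[of 1 x] padic_power_dvd_iff[of 1 y]
      padic_approx_range[of x 1] padic_approx_range[of y 1] zdvd_not_zless
    by (metis order_le_less power_one_right)
qed

text \<open>All residues of \<open>x\<close> at positive levels are prime to \<open>p\<close>, so
  inverses exist modulo each power of \<open>p\<close>, and their uniqueness makes them
  coherent.\<close>

lemma padic_unit: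
  fixes x :: "'p :: prime_card padic_int"
  assumes "\<not> pp dvd x"
  obtains y where "x * y = 1"
proof -
  let ?p = "int CARD('p)"
  have p: "prime ?p" using prime_card[where 'a = 'p] by simp
  have cop: "coprime (padic_approx x n) (?p ^ n)" for n
  proof (cases "n = 0")
    case n: False
    have "\<not> ?p dvd padic_approx x n"
    proof
      assume "?p dvd padic_approx x n"
      moreover have "padic_approx x n mod ?p = padic_approx x 1"
        using padic_approx_add_mod[of x 1 "n - 1"] n by simp
      ultimately show False using assms padic_power_dvd_iff[of 1 x] by auto
    qed
    then show ?thesis using prime_imp_coprime[OF p] by (simp add: coprime_commute)
  qed simp
  have "\<exists>z. 0 \<le> z \<and> z < ?p ^ n \<and> [padic_approx x n * z = 1] (mod ?p ^ n)" for n
  proof -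
    obtain w where "[padic_approx x n * w = 1] (mod ?p ^ n)"
      using cong_solve_coprime_int[OF cop] by blast
    then have "[padic_approx x n * (w mod ?p ^ n) = 1] (mod ?p ^ n)"
      by (simp add: cong_def mod_simps)
    moreover have "?p ^ n > 0" using card_pos[where 'p = 'p] by simp
    ultimately show ?thesis by (intro exI[of _ "w mod ?p ^ n"]) simp
  qed
  then obtain z where z: "\<And>n. 0 \<le> z n" "\<And>n. z n < ?p ^ n"
      "\<And>n. [padic_approx x n * z n = 1] (mod ?p ^ n)" by metis
  have coh: "z (Suc n) mod ?p ^ n = z n" for n
  proof -
    have "[padic_approx x (Suc n) * z (Suc n) = 1] (mod ?p ^ n)"
      using z(3)[of "Suc n"] by (rule cong_dvd_modulus) (simp add: le_imp_power_dvd)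
    moreover have "[padic_approx x (Suc n) = padic_approx x n] (mod ?p ^ n)"
      using padic_approx_Suc_mod[of x n] by (metis cong_def mod_mod_trivial)
    ultimately have "[padic_approx x n * z (Suc n) = padic_approx x n * z n] (mod ?p ^ n)"
      using z(3)[of n] by (meson cong_scalar_right cong_sym cong_trans)
    then have "[z (Suc n) = z n] (mod ?p ^ n)"
      using cop by (metis cong_mult_lcancel)
    then show ?thesis using z(1,2)[of n] by (simp add: cong_def)
  qed
  define y :: "'p padic_int" where "y = Abs_padic_int z"
  have y: "padic_approx y = z"
    unfolding y_def using z coh by (intro Abs_padic_int_inverse) auto
  have "x * y = 1"
  proof (rule padic_int_eqI)
    fix n
    show "padic_approx (x * y) n = padic_approx (1 :: 'p padic_int) n"
      using z(3)[of n] by (simp add: padic_approx_mult padic_approx_1 y cong_def)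
  qed
  then show ?thesis using that by blast
qed

text \<open>An explicit candidate for the function that \<open>padic_Gamma\<close> only describes,
  given by its residues. Their coherence is proved next for odd \<open>p\<close>.\<close>

definition morita_Gamma :: "'p :: prime_card padic_int \<Rightarrow> 'p padic_int" where
  "morita_Gamma x = Abs_padic_int (\<lambda>k. morita CARD('p) (nat (padic_approx x k)) mod int CARD('p) ^ k)"

context
  assumes odd_p: "odd CARD('p :: prime_card)"
begin

lemma padic_approx_morita_Gamma:
  "padic_approx (morita_Gamma (x :: 'p padic_int)) k
     = morita CARD('p) (nat (padic_approx x k)) mod int CARD('p) ^ k"
proof -
  let ?p = "CARD('p)"
  have "morita ?p (nat (padic_approx x (Suc k))) mod int ?p ^ Suc k mod int ?p ^ k
      = morita ?p (nat (padic_approx x k)) mod int ?p ^ k" for k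
  proof -
    have "[int (nat (padic_approx x (Suc k))) = int (nat (padic_approx x k))] (mod int (?p ^ k))"
      using padic_approx_Suc_mod[of x k] padic_approx_range(1)[of x]
      by (simp add: cong_def) (metis mod_mod_trivial padic_approx_Suc_mod)
    then have "[nat (padic_approx x (Suc k)) = nat (padic_approx x k)] (mod ?p ^ k)"
      by (simp only: cong_int_iff)
    then have "[morita ?p (nat (padic_approx x (Suc k))) = morita ?p (nat (padic_approx x k))] (mod int ?p ^ k)"
      by (intro morita_cong prime_card odd_p)
    then show ?thesis unfolding mod_power_Suc_mod cong_def .
  qed
  then show ?thesis
    unfolding morita_Gamma_def using card_pos[where 'p = 'p] by (subst Abs_padic_int_inverse) simp_all
qed

lemma morita_Gamma_of_nat: "morita_Gamma (of_nat n) = (of_int (morita CARD('p) n) :: 'p padic_int)"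
proof (rule padic_int_eqI)
  fix k
  have "[nat (padic_approx (of_nat n :: 'p padic_int) k) = n] (mod CARD('p) ^ k)"
    by (simp add: padic_approx_of_nat cong_def flip: of_nat_power zmod_int)
  then have "[morita CARD('p) (nat (padic_approx (of_nat n :: 'p padic_int) k)) = morita CARD('p) n]
      (mod int CARD('p) ^ k)"
    using prime_card odd_p by (intro morita_cong)
  then show "padic_approx (morita_Gamma (of_nat n :: 'p padic_int)) k
      = padic_approx (of_int (morita CARD('p) n) :: 'p padic_int) k"
    by (simp add: padic_approx_morita_Gamma padic_approx_of_int cong_def)
qed

lemma morita_Gamma_cong:
  "pp ^ k dvd x - y \<Longrightarrow> pp ^ k dvd morita_Gamma x - morita_Gamma (y :: 'p padic_int)"
  by (simp add: padic_power_dvd_diff_iff padic_approx_morita_Gamma)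

lemma dist_padic_le:
  "pp ^ k dvd x - y \<Longrightarrow> dist x (y :: 'p padic_int) \<le> 1 / real CARD('p) ^ k"
  using prime_gt_1_nat[OF prime_card[where 'a = 'p]]
  by (auto simp: dist_padic_int_def padic_val_iff intro!: divide_left_mono power_increasing)

lemma dist_morita_Gamma_le: "dist (morita_Gamma x) (morita_Gamma y) \<le> dist x (y :: 'p padic_int)"
proof (cases "x = y")
  case False
  then have "pp ^ padic_val (x - y) dvd x - y" by (simp add: padic_val_iff)
  then have "dist (morita_Gamma x) (morita_Gamma y) \<le> 1 / real CARD('p) ^ padic_val (x - y)"
    by (intro dist_padic_le morita_Gamma_cong)
  then show ?thesis using False by (simp add: dist_padic_int_def)
qed simp

text \<open>Existence: the candidate is 1-Lipschitz, hence continuous, and has the prescribed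
  values. Uniqueness: the least residues \<open>X k\<close> of \<open>x\<close> are natural numbers
  converging to \<open>x\<close>, and continuous functions that agree on them agree at
  \<open>x\<close>.\<close>

lemma padic_Gamma_eq_morita_Gamma: "padic_Gamma = (morita_Gamma :: 'p padic_int \<Rightarrow> 'p padic_int)"
  unfolding padic_Gamma_def
proof (rule the_equality)
  have val: "morita_Gamma (of_nat n) = ((-1) ^ n * of_nat (\<Prod>j | 1 \<le> j \<and> j < n \<and> \<not> CARD('p) dvd j. j) :: 'p padic_int)"
    for n unfolding morita_Gamma_of_nat morita_def by simp
  have "continuous_on UNIV (morita_Gamma :: 'p padic_int \<Rightarrow> _)"
    unfolding continuous_on_def tendsto_iff eventually_at
    by (metis dist_morita_Gamma_le order_le_less_trans)
  then show "continuous_on UNIV (morita_Gamma :: 'p padic_int \<Rightarrow> _) \<and> morita_Gamma (0 :: 'p padic_int) = 1 \<and>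
     (\<forall>n\<ge>1. morita_Gamma (of_nat n) = ((-1) ^ n * of_nat (\<Prod>j | 1 \<le> j \<and> j < n \<and> \<not> CARD('p) dvd j. j) :: 'p padic_int))"
    using val[of 0] val by auto
  fix f :: "'p padic_int \<Rightarrow> 'p padic_int"
  assume f: "continuous_on UNIV f \<and> f 0 = 1 \<and>
     (\<forall>n\<ge>1. f (of_nat n) = (-1) ^ n * of_nat (\<Prod>j | 1 \<le> j \<and> j < n \<and> \<not> CARD('p) dvd j. j))"
  have nat: "f (of_nat n) = morita_Gamma (of_nat n)" for n
    using f val[of n] val[of 0] by (cases "n = 0") auto
  show "f = morita_Gamma"
  proof
    fix x :: "'p padic_int"
    define X where "X k = (of_nat (nat (padic_approx x k)) :: 'p padic_int)" for k
    have le: "dist (X k) x \<le> (1 / real CARD('p)) ^ k" for k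
    proof -
      obtain n where "pp ^ k dvd x - of_nat n" "padic_approx x k = int n" by (rule padic_nat_approx)
      then show ?thesis using dist_padic_le[of k x "X k"] by (simp add: X_def dist_commute power_one_over)
    qed
    have lim: "(\<lambda>k. (1 / real CARD('p)) ^ k) \<longlonglongrightarrow> 0"
      using prime_gt_1_nat[OF prime_card[where 'a = 'p]] by (intro LIMSEQ_power_zero) simp
    have X: "X \<longlonglongrightarrow> x"
      by (rule metric_tendsto_imp_tendsto[OF lim]) (simp add: le)
    have "(\<lambda>k. f (X k)) \<longlonglongrightarrow> f x"
      using f X continuous_on_tendsto_compose[of UNIV f X x] by simp
    moreover have "(\<lambda>k. morita_Gamma (X k)) \<longlonglongrightarrow> morita_Gamma x"
      using X continuous_on_tendsto_compose[OF \<open>continuous_on UNIV morita_Gamma\<close>, of X x] by simp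
    moreover have "f (X k) = morita_Gamma (X k)" for k unfolding X_def by (rule nat)
    ultimately show "f x = morita_Gamma x" by (metis (no_types, lifting) LIMSEQ_unique ext)
  qed
qed

section \<open>Functional equation and unit values of the gamma function\<close>

lemma padic_Gamma_of_nat: "padic_Gamma (of_nat n :: 'p padic_int) = of_int (morita CARD('p) n)"
  by (simp add: padic_Gamma_eq_morita_Gamma morita_Gamma_of_nat)

lemma padic_Gamma_cong:
  "pp ^ k dvd x - y \<Longrightarrow> pp ^ k dvd padic_Gamma x - padic_Gamma (y :: 'p padic_int)"
  by (simp add: padic_Gamma_eq_morita_Gamma morita_Gamma_cong)

text \<open>The equation holds at natural numbers and passes to \<open>x\<close> by approximation,
  since the case distinction depends only on \<open>x\<close> modulo \<open>p\<close>.\<close>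

lemma padic_Gamma_plus_one:
  "padic_Gamma (x + 1) = (if pp dvd x then - 1 else - x) * padic_Gamma (x :: 'p padic_int)"
proof (rule padic_int_eq_if_dvd)
  fix k
  let ?c = "\<lambda>x :: 'p padic_int. if pp dvd x then - 1 else - x"
  \<comment> \<open>Precision \<open>Suc k\<close> instead of \<open>k\<close> ensures a congruence
    modulo \<open>p\<close> even for \<open>k = 0\<close>, so that \<open>x\<close> and
    \<open>n\<close> fall under the same case.\<close>
  obtain n where n: "pp ^ Suc k dvd x - of_nat n" by (rule padic_nat_approx)
  then have "pp dvd x - of_nat n" by (meson dvd_power dvd_trans zero_less_Suc)
  then have iff: "pp dvd x \<longleftrightarrow> pp dvd (of_nat n :: 'p padic_int)"
    by (metis diff_add_cancel dvd_add_right_iff)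
  have "pp ^ Suc k dvd of_nat n - x" using n by (metis dvd_minus_iff minus_diff_eq)
  then have c: "pp ^ Suc k dvd ?c x - ?c (of_nat n)"
    using iff by simp
  have "padic_Gamma (of_nat n + 1 :: 'p padic_int) = ?c (of_nat n) * padic_Gamma (of_nat n)"
    using padic_Gamma_of_nat[of "Suc n"]
    by (simp add: padic_Gamma_of_nat morita_Suc padic_dvd_of_nat_iff add.commute)
  then have "padic_Gamma (x + 1) - ?c x * padic_Gamma x
      = (padic_Gamma (x + 1) - padic_Gamma (of_nat n + 1)) - (?c x - ?c (of_nat n)) * padic_Gamma x
        - ?c (of_nat n) * (padic_Gamma x - padic_Gamma (of_nat n))"
    by (simp add: algebra_simps)
  also have "pp ^ Suc k dvd \<dots>"
    using n by (intro dvd_diff[OF dvd_diff[OF padic_Gamma_cong dvd_mult2[OF c]] dvd_mult[OF padic_Gamma_cong]]) simp_all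
  finally show "pp ^ k dvd padic_Gamma (x + 1) - ?c x * padic_Gamma x"
    by (meson dvd_trans le_imp_power_dvd le_SucI order_refl)
qed

lemma not_pp_dvd_padic_Gamma: "\<not> pp dvd padic_Gamma (x :: 'p padic_int)"
proof -
  have m: "\<not> int CARD('p) dvd morita CARD('p) n" for n
  proof (induction n)
    case (Suc n)
    have "prime (int CARD('p))" using prime_card[where 'a = 'p] by simp
    then show ?case using Suc by (auto simp: morita_Suc prime_dvd_mult_iff)
  qed (use prime_gt_1_nat[OF prime_card[where 'a = 'p]] in simp)
  obtain n where "pp ^ 1 dvd x - of_nat n" by (rule padic_nat_approx)
  then have "pp dvd padic_Gamma x - padic_Gamma (of_nat n)"
    using padic_Gamma_cong[of 1] by simp
  moreover have "\<not> (pp :: 'p padic_int) dvd padic_Gamma (of_nat n)"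
    using m[of n] padic_power_dvd_of_int_iff[where 'p = 'p, of 1] by (simp add: padic_Gamma_of_nat)
  ultimately show ?thesis by (metis add_diff_cancel_left' diff_diff_eq2 dvd_diff)
qed

text \<open>Iterated functional equation: by assumption no factor \<open>x + i\<close> is divisible
  by \<open>p\<close>, so the exceptional factor \<open>-1\<close> never occurs. It turns Whipple's
  Pochhammer prefactor into gamma values.\<close>

lemma padic_Gamma_plus_of_nat:
  assumes "\<not> pp dvd pochhammer x n"
  shows "padic_Gamma (x + of_nat n) = (-1) ^ n * pochhammer x n * padic_Gamma (x :: 'p padic_int)"
  using assms
proof (induction n)
  case (Suc n)
  then have *: "\<not> pp dvd pochhammer x n" "\<not> pp dvd x + of_nat n"
    by (auto simp: pochhammer_Suc)
  show ?case
    using padic_Gamma_plus_one[of "x + of_nat n"] * Suc by (simp add: pochhammer_Suc algebra_simps)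
qed simp

end

section \<open>Affine behaviour modulo the square of the prime\<close>

text \<open>Triples that agree modulo \<open>p\<^sup>2\<close> with the values at \<open>1, 0, -1\<close> of \<open>t \<mapsto> y + p * u * t\<close>.\<close>

definition padic_affine :: "'p :: prime_card padic_int \<Rightarrow> 'p padic_int \<Rightarrow> 'p padic_int \<Rightarrow> bool" where
  "padic_affine x y z \<longleftrightarrow> (\<exists>u w. x = y + pp * u \<and> z = y - pp * u + pp ^ 2 * w)"

lemma padic_affine_line: "padic_affine (x + pp * k) x (x - pp * k)"
  unfolding padic_affine_def by (intro exI[of _ k] exI[of _ 0]) simp

lemma padic_affine_const: "padic_affine c c c"
  using padic_affine_line[of c 0] by simp

lemma padic_affine_add:
  assumes "padic_affine x y z" "padic_affine x' y' z'"
  shows "padic_affine (x + x') (y + y') (z + z')"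
proof -
  from assms obtain u w u' w' where *: "x = y + pp * u" "z = y - pp * u + pp ^ 2 * w"
    "x' = y' + pp * u'" "z' = y' - pp * u' + pp ^ 2 * w'" unfolding padic_affine_def by blast
  show ?thesis
    unfolding padic_affine_def * by (intro exI[of _ "u + u'"] exI[of _ "w + w'"]) (simp add: algebra_simps)
qed

lemma padic_affine_mult:
  assumes "padic_affine x y z" "padic_affine x' y' z'"
  shows "padic_affine (x * x') (y * y') (z * z')"
proof -
  from assms obtain u w u' w' where *: "x = y + pp * u" "z = y - pp * u + pp ^ 2 * w"
    "x' = y' + pp * u'" "z' = y' - pp * u' + pp ^ 2 * w'" unfolding padic_affine_def by blast
  \<comment> \<open>The value at \<open>1\<close> must be matched exactly, so the slope absorbs
    \<open>pp * u * u'\<close>. At \<open>-1\<close> that term then has the wrong sign, whence the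
    coefficient \<open>2\<close>.\<close>
  show ?thesis
    unfolding padic_affine_def *
    by (intro exI[of _ "y * u' + u * y' + pp * u * u'"]
        exI[of _ "2 * u * u' + w * y' + y * w' - pp * (u * w' + w * u') + pp ^ 2 * w * w'"])
      (simp add: algebra_simps power2_eq_square)
qed

lemma padic_affine_uminus: "padic_affine x y z \<Longrightarrow> padic_affine (- x) (- y) (- z)"
  using padic_affine_mult[OF padic_affine_const[of "-1"], of x y z] by simp

lemma padic_affine_inverse:
  assumes "padic_affine x y z" and inv: "x * x' = 1" "y * y' = 1" "z * z' = 1"
  shows "padic_affine x' y' z'"
proof -
  from assms(1) obtain u w where x: "x = y + pp * u" and z: "z = y - pp * u + pp ^ 2 * w"
    unfolding padic_affine_def by blast
  have x': "x' = y' + pp * (- (u * x' * y'))"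
  proof -
    have "x' - y' = x' * (y * y') - y' * (x * x')" by (simp add: inv)
    also have "\<dots> = pp * (- (u * x' * y'))" unfolding x by (simp add: algebra_simps)
    finally show ?thesis by (simp add: algebra_simps)
  qed
  \<comment> \<open>Factors equal to \<open>1\<close> are inserted so that
    \<open>x' * y' * z'\<close> can be extracted; in the remaining bracket the terms linear in
    \<open>pp\<close> cancel.\<close>
  have "z' - (y' - pp * (- (u * x' * y')))
      = z' * (y * y') * (x * x') - (y' * (z * z') * (x * x') + pp * u * x' * y' * (z * z'))"
    by (simp add: inv)
  also have "\<dots> = x' * y' * z' * (x * (y - z) - pp * u * z)"
    by (simp add: algebra_simps)
  also have "\<dots> = pp ^ 2 * (x' * y' * z' * (2 * u * u - w * y - 2 * pp * u * w))"
    unfolding x z by (simp add: algebra_simps power2_eq_square)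
  finally show ?thesis
    unfolding padic_affine_def using x' by (metis add.commute diff_add_cancel)
qed

text \<open>The outer values add up to twice the middle one modulo \<open>pp ^ 2\<close>, and
  \<open>2\<close> is a unit for odd \<open>p\<close>.\<close>

lemma padic_affine_middle:
  assumes "odd CARD('p :: prime_card)" and "padic_affine (0 :: 'p padic_int) y 0"
  shows "pp ^ 2 dvd y"
proof -
  from assms(2) obtain u w where "0 = y + pp * u" "0 = y - pp * u + pp ^ 2 * w"
    unfolding padic_affine_def by blast
  then have "2 * y = pp ^ 2 * (- w)"
    by (simp add: mult_2 algebra_simps eq_neg_iff_add_eq_0)
  moreover have "\<not> CARD('p) dvd 2"
    using assms(1) prime_card[where 'a = 'p] by (metis dvd_refl primes_dvd_imp_eq two_is_prime_nat)
  then have "\<not> (pp :: 'p padic_int) dvd 2"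
    using padic_dvd_of_nat_iff[where 'p = 'p, of 2] by simp
  then obtain t where "(2 :: 'p padic_int) * t = 1" by (rule padic_unit)
  ultimately have "y = pp ^ 2 * (- w * t)"
    by (metis mult.assoc mult.commute mult.right_neutral)
  then show ?thesis by simp
qed

text \<open>On multiples of \<open>p\<close> the function is \<open>1 + c\<close> times the argument
  modulo \<open>p ^ 2\<close>, by \<open>morita_prime_mult\<close> and approximation. The functional
  equation, whose factor is itself affine, carries this to every residue class.\<close>

lemma padic_affine_Gamma:
  fixes x k :: "'p :: prime_card padic_int"
  assumes p: "odd CARD('p)"
  shows "padic_affine (padic_Gamma (x + pp * k)) (padic_Gamma x) (padic_Gamma (x - pp * k))"
proof -
  obtain c where c: "\<And>m. [morita CARD('p) (CARD('p) * m) = 1 + int CARD('p) * int m * c] (mod int CARD('p) ^ 2)"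
    using morita_prime_mult[OF prime_card p] by blast
  have lin: "pp ^ 2 dvd padic_Gamma (pp * y) - (1 + pp * y * of_int c)" for y :: "'p padic_int"
  proof -
    obtain m where m: "pp ^ 2 dvd y - of_nat m" by (rule padic_nat_approx)
    have "pp ^ 2 dvd (of_int (morita CARD('p) (CARD('p) * m) - (1 + int CARD('p) * int m * c)) :: 'p padic_int)"
      using c[of m] unfolding padic_power_dvd_of_int_iff by (simp add: cong_iff_dvd_diff)
    then have 1: "pp ^ 2 dvd padic_Gamma (pp * of_nat m) - (1 + pp * of_nat m * of_int c :: 'p padic_int)"
      using padic_Gamma_of_nat[OF p, of "CARD('p) * m"] by simp
    have "pp * y - pp * of_nat m = pp * (y - of_nat m)" by (simp add: algebra_simps)
    then have 2: "pp ^ 2 dvd padic_Gamma (pp * y) - padic_Gamma (pp * of_nat m)"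
      using m by (intro padic_Gamma_cong[OF p]) simp
    have "padic_Gamma (pp * y) - (1 + pp * y * of_int c)
        = (padic_Gamma (pp * y) - padic_Gamma (pp * of_nat m))
        + (padic_Gamma (pp * of_nat m) - (1 + pp * of_nat m * of_int c)) - pp * of_int c * (y - of_nat m)"
      by (simp add: algebra_simps)
    also have "pp ^ 2 dvd \<dots>" by (rule dvd_diff[OF dvd_add[OF 2 1] dvd_mult[OF m]])
    finally show ?thesis .
  qed
  have base: "padic_affine (padic_Gamma (pp * t + pp * k)) (padic_Gamma (pp * t)) (padic_Gamma (pp * t - pp * k))" for t
  proof -
    obtain w0 w1 w2 where w:
      "padic_Gamma (pp * t) - (1 + pp * t * of_int c) = pp ^ 2 * w0"
      "padic_Gamma (pp * (t + k)) - (1 + pp * (t + k) * of_int c) = pp ^ 2 * w1"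
      "padic_Gamma (pp * (t - k)) - (1 + pp * (t - k) * of_int c) = pp ^ 2 * w2"
      using lin[of t] lin[of "t + k"] lin[of "t - k"] by (auto elim!: dvdE)
    have e: "pp * t + pp * k = pp * (t + k)" "pp * t - pp * k = pp * (t - k)" by (simp_all add: algebra_simps)
    have w': "padic_Gamma (pp * t) = 1 + pp * t * of_int c + pp ^ 2 * w0"
      "padic_Gamma (pp * (t + k)) = 1 + pp * (t + k) * of_int c + pp ^ 2 * w1"
      "padic_Gamma (pp * (t - k)) = 1 + pp * (t - k) * of_int c + pp ^ 2 * w2"
      using w by (metis add.commute diff_add_cancel)+
    show ?thesis
      unfolding padic_affine_def e w'
      by (intro exI[of _ "k * of_int c + pp * (w1 - w0)"] exI[of _ "w1 + w2 - 2 * w0"])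
        (simp add: algebra_simps power2_eq_square)
  qed
  have "padic_affine (padic_Gamma (of_nat r + pp * t + pp * k)) (padic_Gamma (of_nat r + pp * t))
      (padic_Gamma (of_nat r + pp * t - pp * k))" for r t
  proof (induction r)
    case 0
    then show ?case using base by simp
  next
    case (Suc r)
    let ?y = "of_nat r + pp * t"
    let ?c = "\<lambda>x :: 'p padic_int. if pp dvd x then - 1 else - x"
    have e: "of_nat (Suc r) + pp * t = ?y + 1" "?y + 1 + pp * k = (?y + pp * k) + 1"
      "?y + 1 - pp * k = (?y - pp * k) + 1" by simp_all
    \<comment> \<open>The three points are congruent modulo \<open>p\<close>, so the same branch of
      the functional equation applies to all of them.\<close>
    have "pp dvd ?y + pp * k \<longleftrightarrow> pp dvd ?y" "pp dvd ?y - pp * k \<longleftrightarrow> pp dvd ?y"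
      using dvd_add_left_iff[of pp "pp * k" ?y] dvd_add_left_iff[of pp "- (pp * k)" ?y] by simp_all
    then have "padic_affine (?c (?y + pp * k)) (?c ?y) (?c (?y - pp * k))"
      using padic_affine_const[of "-1 :: 'p padic_int"] padic_affine_uminus[OF padic_affine_line[of ?y k]] by simp
    from padic_affine_mult[OF this Suc] show ?case
      unfolding e padic_Gamma_plus_one[OF p] .
  qed
  moreover obtain r where "pp ^ 1 dvd x - of_nat r" by (rule padic_nat_approx)
  then obtain t where "x = of_nat r + pp * t" by (metis add.commute diff_add_cancel dvdE power_one_right)
  ultimately show ?thesis by simp
qed

section \<open>Divisibility of Pochhammer symbols by the prime\<close>

lemma pp_dvd_of_nat_diff_iff:
  assumes "i < CARD('p :: prime_card)" "m < CARD('p)"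
  shows "(pp :: 'p padic_int) dvd of_nat i - of_nat m \<longleftrightarrow> i = m"
proof -
  have "(pp :: 'p padic_int) dvd of_nat i - of_nat m \<longleftrightarrow> int CARD('p) dvd int i - int m"
    using padic_power_dvd_of_int_iff[where 'p = 'p, of 1 "int i - int m"] by simp
  also have "\<dots> \<longleftrightarrow> i = m"
    using assms by (auto dest!: cong_iff_dvd_diff[THEN iffD2] simp: cong_def)
  finally show ?thesis .
qed

text \<open>Modulo \<open>p\<close> the factor \<open>x + i\<close> is \<open>i - m\<close>, which
  for \<open>i < p\<close> vanishes only at \<open>i = m\<close>.\<close>

lemma pp_dvd_pochhammer_iff:
  fixes x :: "'p :: prime_card padic_int"
  assumes x: "pp dvd x + of_nat m" and m: "m < CARD('p)" and k: "k \<le> CARD('p)"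
  shows "pp dvd pochhammer x k \<longleftrightarrow> m < k"
  using k
proof (induction k)
  case 0
  then show ?case using prime_elem_pp[where 'p = 'p] by (auto simp: prime_elem_def)
next
  case (Suc k)
  have "x + of_nat k = (x + of_nat m) + (of_nat k - of_nat m)" by simp
  then have "pp dvd x + of_nat k \<longleftrightarrow> k = m"
    using x m Suc.prems by (metis Suc_le_lessD dvd_add_right_iff pp_dvd_of_nat_diff_iff)
  then show ?case
    using Suc by (auto simp: pochhammer_Suc prime_elem_dvd_mult_iff[OF prime_elem_pp])
qed

section \<open>Congruences and integrality in the field of p-adic numbers\<close>

lemma to_fract_of_nat [simp]: "to_fract (of_nat n) = of_nat n"
  by (simp add: to_fract_def of_nat_fract)

lemma to_fract_pochhammer: "to_fract (pochhammer x n) = pochhammer (to_fract x) n"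
  by (induction n) (simp_all add: pochhammer_Suc)

lemma padic_cong_trans: "padic_cong n x y \<Longrightarrow> padic_cong n y z \<Longrightarrow> padic_cong n x z"
  unfolding padic_cong_def
proof (elim exE)
  fix u v assume "x - y = to_fract (pp ^ n * u)" "y - z = to_fract (pp ^ n * v)"
  then have "x - z = to_fract (pp ^ n * u) + to_fract (pp ^ n * v)"
    by (metis diff_add_cancel diff_add_eq_diff_diff_swap add_diff_eq)
  then show "\<exists>w. x - z = to_fract (pp ^ n * w)"
    by (intro exI[of _ "u + v"]) (simp add: distrib_left)
qed

lemma padic_cong_sym: "padic_cong n x y \<Longrightarrow> padic_cong n y x"
  unfolding padic_cong_def by (metis minus_diff_eq mult_minus_right to_fract_uminus)

lemma padic_cong_mult_left:
  assumes "padic_cong n x y" shows "padic_cong n (to_fract c * x) (to_fract c * y)"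
proof -
  from assms obtain u where "x - y = to_fract (pp ^ n * u)" unfolding padic_cong_def by blast
  moreover have "to_fract c * x - to_fract c * y = to_fract c * (x - y)"
    by (simp add: right_diff_distrib)
  ultimately have "to_fract c * x - to_fract c * y = to_fract (pp ^ n * (c * u))"
    by simp
  then show ?thesis unfolding padic_cong_def by blast
qed

lemma to_fract_inverse_unit:
  fixes x :: "'p :: prime_card padic_int"
  assumes "\<not> pp dvd x"
  obtains y where "x * y = 1" "inverse (to_fract x) = to_fract y"
proof -
  obtain y where y: "x * y = 1" using padic_unit[OF assms] .
  then have "to_fract x * to_fract y = 1" by (metis to_fract_1 to_fract_mult)
  then have "inverse (to_fract x) = to_fract y" by (rule inverse_unique)
  with y show ?thesis by (rule that)
qed

text \<open>If \<open>p\<close> divides the denominator then \<open>n < k\<close>, hence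
  \<open>m < k\<close> and \<open>p\<close> divides the numerator as well. After cancelling one
  \<open>p\<close>, the assumption \<open>sq\<close> leaves a unit below.\<close>

lemma pochhammer_divide_integral:
  fixes x y :: "'p :: prime_card padic_int"
  assumes x: "pp dvd x + of_nat m" "m < CARD('p)" and y: "pp dvd y + of_nat n" "n < CARD('p)"
    and mn: "m \<le> n" and k: "k \<le> CARD('p)" and sq: "\<not> pp ^ 2 dvd pochhammer y k"
  obtains t where "to_fract (pochhammer x k) / to_fract (pochhammer y k) = to_fract t"
proof (cases "n < k")
  case False
  then have "\<not> pp dvd pochhammer y k" using pp_dvd_pochhammer_iff[OF y k] by simp
  then obtain z where "inverse (to_fract (pochhammer y k)) = to_fract z"
    by (rule to_fract_inverse_unit)
  then show ?thesis using that[of "pochhammer x k * z"] by (simp add: divide_inverse)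
next
  case True
  then obtain u v where uv: "pochhammer x k = pp * u" "pochhammer y k = pp * v"
    using pp_dvd_pochhammer_iff[OF x k] pp_dvd_pochhammer_iff[OF y k] mn by (auto elim!: dvdE)
  then have "\<not> pp dvd v" using sq by (auto simp: power2_eq_square)
  then obtain z where z: "inverse (to_fract v) = to_fract z"
    by (rule to_fract_inverse_unit)
  have "(of_nat CARD('p) :: 'p padic) \<noteq> 0" using prime_gt_0_nat[OF prime_card[where 'a = 'p]] by simp
  then have "to_fract (pochhammer x k) / to_fract (pochhammer y k) = to_fract u / to_fract v"
    unfolding uv by simp
  then show ?thesis using that[of "u * z"] z by (simp add: divide_inverse)
qed

lemma fact_not_dvd:
  assumes "k < CARD('p :: prime_card)"
  shows "\<not> (pp :: 'p padic_int) dvd fact k"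
proof -
  have "\<not> (pp :: 'p padic_int) dvd of_nat (fact k)"
    unfolding padic_dvd_of_nat_iff using assms prime_dvd_fact_iff[OF prime_card[where 'a = 'p], of k] by simp
  then show ?thesis by simp
qed

lemma to_fract_fact [simp]: "to_fract (fact n :: 'a :: {idom, ring_char_0}) = fact n"
  by (metis of_nat_fact to_fract_of_nat)

section \<open>Truncation modulo the square of the prime\<close>

lemma hypergeom_trunc_4F3:
  "hypergeom_trunc [r, a, b, c] [1, d, e] 1 n
     = (\<Sum>k\<le>n. pochhammer r k * pochhammer a k * pochhammer b k * pochhammer c k
          / (fact k * pochhammer d k * pochhammer e k * fact k))"
  by (simp add: hypergeom_trunc_def atLeast0AtMost mult_ac flip: pochhammer_fact)

text \<open>Beyond \<open>M\<close> the symbols of \<open>r\<close> and \<open>a\<close> contribute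
  one factor \<open>p\<close> each, while pairing \<open>b\<close> with \<open>d\<close> and
  \<open>c\<close> with \<open>e\<close> keeps the remaining quotients integral.\<close>

lemma hypergeom_trunc_cong:
  fixes r a b c d e :: "'p :: prime_card padic_int"
  assumes r: "pp dvd r + of_nat mr" "mr \<le> M" and a: "pp dvd a + of_nat ma" "ma \<le> M"
    and b: "pp dvd b + of_nat mb" and c: "pp dvd c + of_nat mc"
    and d: "pp dvd d + of_nat md" "md < CARD('p)" "mb \<le> md"
    and e: "pp dvd e + of_nat me" "me < CARD('p)" "mc \<le> me"
    and sq: "\<not> pp ^ 2 dvd pochhammer d (CARD('p) - 1)" "\<not> pp ^ 2 dvd pochhammer e (CARD('p) - 1)"
    and M: "M < CARD('p)"
  shows "padic_cong 2 (hypergeom_trunc (map to_fract [r, a, b, c]) (map to_fract [1, d, e]) 1 (CARD('p) - 1))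
    (hypergeom_trunc (map to_fract [r, a, b, c]) (map to_fract [1, d, e]) 1 M)"
proof -
  define T where "T k = to_fract (pochhammer r k) * to_fract (pochhammer a k) * to_fract (pochhammer b k)
    * to_fract (pochhammer c k) / (fact k * to_fract (pochhammer d k) * to_fract (pochhammer e k) * fact k)" for k
  have tail: "\<exists>t. T k = to_fract (pp ^ 2 * t)" if k: "k \<in> {M<..CARD('p) - 1}" for k
  proof -
    have k': "M < k" "k < CARD('p)" "k \<le> CARD('p)" using k by auto
    have sq': "\<not> pp ^ 2 dvd pochhammer d k" "\<not> pp ^ 2 dvd pochhammer e k"
      \<comment> \<open>A symbol of length \<open>k\<close> divides the one of length
        \<open>CARD('p) - 1\<close>, so non-divisibility is inherited.\<close>
      using sq pochhammer_product[of k "CARD('p) - 1"] k by (metis dvd_mult2 greaterThanAtMost_iff)+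
    obtain u where u: "pochhammer r k = pp * u"
      using pp_dvd_pochhammer_iff[OF r(1) _ k'(3)] r k' by (auto elim!: dvdE)
    obtain v where v: "pochhammer a k = pp * v"
      using pp_dvd_pochhammer_iff[OF a(1) _ k'(3)] a k' by (auto elim!: dvdE)
    obtain x where x: "to_fract (pochhammer b k) / to_fract (pochhammer d k) = to_fract x"
      using pochhammer_divide_integral[OF b _ d k'(3) sq'(1)] d by auto
    obtain y where y: "to_fract (pochhammer c k) / to_fract (pochhammer e k) = to_fract y"
      using pochhammer_divide_integral[OF c _ e k'(3) sq'(2)] e by auto
    obtain z where z: "inverse (fact k) = (to_fract z :: 'p padic)"
      using to_fract_inverse_unit[OF fact_not_dvd[OF k'(2)]] by auto
    have "T k = to_fract (pochhammer r k) * to_fract (pochhammer a k)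
        * (to_fract (pochhammer b k) / to_fract (pochhammer d k))
        * (to_fract (pochhammer c k) / to_fract (pochhammer e k)) * inverse (fact k) * inverse (fact k)"
      unfolding T_def by (simp add: divide_inverse mult_ac)
    also have "\<dots> = to_fract (pp ^ 2 * (u * v * x * y * z * z))"
      unfolding x y z u v by (simp add: power2_eq_square mult_ac)
    finally show ?thesis by blast
  qed
  then obtain t where t: "\<And>k. k \<in> {M<..CARD('p) - 1} \<Longrightarrow> T k = to_fract (pp ^ 2 * t k)" by metis
  have H: "hypergeom_trunc (map to_fract [r, a, b, c]) (map to_fract [1, d, e]) 1 n = (\<Sum>k\<le>n. T k)" for n
    unfolding T_def by (simp add: hypergeom_trunc_4F3 to_fract_pochhammer)
  have split: "{..CARD('p) - 1} = {..M} \<union> {M<..CARD('p) - 1}" using M by auto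
  have "(\<Sum>k\<le>CARD('p) - 1. T k) = (\<Sum>k\<le>M. T k) + (\<Sum>k\<in>{M<..CARD('p) - 1}. T k)"
    unfolding split by (rule sum.union_disjoint) auto
  also have "(\<Sum>k\<in>{M<..CARD('p) - 1}. T k) = (\<Sum>k\<in>{M<..CARD('p) - 1}. to_fract (pp ^ 2 * t k))"
    by (rule sum.cong[OF refl t])
  also have "\<dots> = to_fract (pp ^ 2 * (\<Sum>k\<in>{M<..CARD('p) - 1}. t k))"
    unfolding sum_distrib_left by (induction rule: infinite_finite_induct) simp_all
  finally show ?thesis unfolding padic_cong_def H by (metis add_diff_cancel_left')
qed

section \<open>Affine triples of p-integral elements of the field\<close>

definition fract_affine :: "'p :: prime_card padic \<Rightarrow> 'p padic \<Rightarrow> 'p padic \<Rightarrow> bool" where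
  "fract_affine X Y Z \<longleftrightarrow> (\<exists>x y z. X = to_fract x \<and> Y = to_fract y \<and> Z = to_fract z \<and> padic_affine x y z)"

lemma fract_affine_to_fract: "padic_affine x y z \<Longrightarrow> fract_affine (to_fract x) (to_fract y) (to_fract z)"
  unfolding fract_affine_def by blast

lemma fract_affineE:
  assumes "fract_affine X Y Z"
  obtains x y z where "X = to_fract x" "Y = to_fract y" "Z = to_fract z" "padic_affine x y z"
  using assms unfolding fract_affine_def by blast

lemma fract_affine_add:
  "fract_affine X Y Z \<Longrightarrow> fract_affine X' Y' Z' \<Longrightarrow> fract_affine (X + X') (Y + Y') (Z + Z')"
  by (elim fract_affineE) (simp add: fract_affine_to_fract[OF padic_affine_add, simplified])

lemma fract_affine_mult:
  "fract_affine X Y Z \<Longrightarrow> fract_affine X' Y' Z' \<Longrightarrow> fract_affine (X * X') (Y * Y') (Z * Z')"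
  by (elim fract_affineE) (simp add: fract_affine_to_fract[OF padic_affine_mult, simplified])

lemma fract_affine_uminus: "fract_affine X Y Z \<Longrightarrow> fract_affine (- X) (- Y) (- Z)"
  by (elim fract_affineE) (simp add: fract_affine_to_fract[OF padic_affine_uminus, simplified])

lemma fract_affine_diff:
  "fract_affine X Y Z \<Longrightarrow> fract_affine X' Y' Z' \<Longrightarrow> fract_affine (X - X') (Y - Y') (Z - Z')"
  using fract_affine_add[of X Y Z "- X'" "- Y'" "- Z'", OF _ fract_affine_uminus] by simp

lemma fract_affine_sum:
  "(\<And>k. k \<in> A \<Longrightarrow> fract_affine (X k) (Y k) (Z k)) \<Longrightarrow> fract_affine (sum X A) (sum Y A) (sum Z A)"
proof (induction A rule: infinite_finite_induct)
  case (insert k A)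
  then show ?case by (auto intro: fract_affine_add)
qed (use fract_affine_to_fract[OF padic_affine_const[of 0]] in auto)

lemma padic_affine_pp_dvd_iff:
  assumes "padic_affine x y z"
  shows "pp dvd x \<longleftrightarrow> pp dvd y" "pp dvd z \<longleftrightarrow> pp dvd y"
proof -
  from assms obtain u w where x: "x = y + pp * u" and z: "z = y + pp * (pp * w - u)"
    unfolding padic_affine_def by (auto simp: power2_eq_square algebra_simps)
  show "pp dvd x \<longleftrightarrow> pp dvd y" "pp dvd z \<longleftrightarrow> pp dvd y"
    unfolding x z by (simp_all add: dvd_add_left_iff)
qed

text \<open>A unit in the middle suffices, because the outer denominators are congruent to it modulo
  \<open>p\<close>.\<close>

lemma fract_affine_divide:
  assumes X: "fract_affine X Y Z" and x: "padic_affine x y z" and y: "\<not> pp dvd y"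
  shows "fract_affine (X / to_fract x) (Y / to_fract y) (Z / to_fract z)"
proof -
  note units = padic_affine_pp_dvd_iff[OF x]
  obtain x' where x': "x * x' = 1" "inverse (to_fract x) = to_fract x'"
    using to_fract_inverse_unit[of x] y units by blast
  obtain y' where y': "y * y' = 1" "inverse (to_fract y) = to_fract y'"
    using to_fract_inverse_unit[of y] y by blast
  obtain z' where z': "z * z' = 1" "inverse (to_fract z) = to_fract z'"
    using to_fract_inverse_unit[of z] y units by blast
  have "padic_affine x' y' z'" using padic_affine_inverse[OF x x'(1) y'(1) z'(1)] .
  from fract_affine_mult[OF X fract_affine_to_fract[OF this]] show ?thesis
    by (simp add: divide_inverse x' y' z')
qed

lemma padic_affine_pochhammer:
  "padic_affine x y z \<Longrightarrow> padic_affine (pochhammer x n) (pochhammer y n) (pochhammer z n)"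
  by (induction n)
    (auto simp: pochhammer_Suc intro!: padic_affine_const padic_affine_mult padic_affine_add)

text \<open>Up to \<open>n\<close> the symbols of \<open>d\<close> and \<open>e\<close> have not
  reached their factor divisible by \<open>p\<close>, so every term is a quotient of affine triples
  with unit denominators.\<close>

lemma fract_affine_hypergeom_trunc:
  fixes r a b c d e :: "'p :: prime_card padic_int"
  assumes "padic_affine r' r r''" "padic_affine a' a a''" "padic_affine b' b b''" "padic_affine c' c c''"
    and d: "padic_affine d' d d''" "pp dvd d + of_nat md" "md < CARD('p)" "n \<le> md"
    and e: "padic_affine e' e e''" "pp dvd e + of_nat me" "me < CARD('p)" "n \<le> me"
  shows "fract_affine (hypergeom_trunc (map to_fract [r', a', b', c']) (map to_fract [1, d', e']) 1 n)
      (hypergeom_trunc (map to_fract [r, a, b, c]) (map to_fract [1, d, e]) 1 n)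
      (hypergeom_trunc (map to_fract [r'', a'', b'', c'']) (map to_fract [1, d'', e'']) 1 n)"
proof -
  have H: "hypergeom_trunc (map to_fract [r, a, b, c]) (map to_fract [1, d, e]) 1 n
     = (\<Sum>k\<le>n. to_fract (pochhammer r k * pochhammer a k * pochhammer b k * pochhammer c k)
        / to_fract (fact k * pochhammer d k * pochhammer e k * fact k))"
    for r a b c d e :: "'p padic_int" by (simp add: hypergeom_trunc_4F3 to_fract_pochhammer)
  show ?thesis
    unfolding H
  proof (rule fract_affine_sum)
    fix k assume "k \<in> {..n}"
    then have k: "k \<le> md" "k \<le> me" "k < CARD('p)" "k \<le> CARD('p)" using d e by auto
    have "\<not> pp dvd fact k * pochhammer d k * pochhammer e k * fact k"
      using pp_dvd_pochhammer_iff[OF d(2,3) k(4)] pp_dvd_pochhammer_iff[OF e(2,3) k(4)] k(1,2)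
        fact_not_dvd[OF k(3)]
      by (simp add: prime_elem_dvd_mult_iff[OF prime_elem_pp])
    then show "fract_affine
        (to_fract (pochhammer r' k * pochhammer a' k * pochhammer b' k * pochhammer c' k)
          / to_fract (fact k * pochhammer d' k * pochhammer e' k * fact k))
        (to_fract (pochhammer r k * pochhammer a k * pochhammer b k * pochhammer c k)
          / to_fract (fact k * pochhammer d k * pochhammer e k * fact k))
        (to_fract (pochhammer r'' k * pochhammer a'' k * pochhammer b'' k * pochhammer c'' k)
          / to_fract (fact k * pochhammer d'' k * pochhammer e'' k * fact k))"
      by (intro fract_affine_divide fract_affine_to_fract padic_affine_mult padic_affine_pochhammer
          padic_affine_const assms d(1) e(1))
  qed
qed

section \<open>Whipple's transformation with p-adic gamma factors\<close>

lemma hypergeom_trunc_terminating: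
  fixes r b c d e :: "'a :: field_char_0"
  assumes "n \<le> M"
  shows "hypergeom_trunc [r, - of_nat n, b, c] [1, d, e] 1 M = hypergeom_trunc [r, - of_nat n, b, c] [1, d, e] 1 n"
  unfolding hypergeom_trunc_4F3 using assms
  by (intro sum.mono_neutral_right) (auto simp: pochhammer_of_nat_eq_0_iff)

definition Gamma_quotient :: "'p :: prime_card padic_int \<Rightarrow> _ \<Rightarrow> _ \<Rightarrow> _ \<Rightarrow> _ \<Rightarrow> _ \<Rightarrow> 'p padic" where
  "Gamma_quotient r a b c d e =
     to_fract (padic_Gamma (b + c - d) * padic_Gamma (b + c - e) * padic_Gamma d * padic_Gamma e)
     / to_fract (padic_Gamma (d - r) * padic_Gamma (e - r) * padic_Gamma (d - a) * padic_Gamma (e - a))"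

text \<open>Whipple's transformation with \<open>r\<close> as its parameter \<open>a\<close> and
  with lower parameters \<open>1\<close>, \<open>d\<close>, \<open>e\<close>, so that its
  \<open>d - b\<close> and \<open>d - c\<close> become \<open>1 - b\<close> and
  \<open>1 - c\<close>. The four unit conditions turn the prefactor into gamma values.\<close>

lemma padic_whipple:
  fixes r b c d e :: "'p :: prime_card padic_int"
  assumes p: "odd CARD('p)" and bal: "d + e = r - of_nat n + b + c"
    and d: "\<not> pp dvd pochhammer d n" and e: "\<not> pp dvd pochhammer e n"
    and dr: "\<not> pp dvd pochhammer (d - r) n" and er: "\<not> pp dvd pochhammer (e - r) n"
    and M: "n \<le> M"
  shows "hypergeom_trunc (map to_fract [r, - of_nat n, b, c]) (map to_fract [1, d, e]) 1 M
    = Gamma_quotient r (- of_nat n) b c d e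
      * hypergeom_trunc (map to_fract [r, - of_nat n, 1 - b, 1 - c])
          (map to_fract [1, 1 + d - b - c, 1 + e - b - c]) 1 M"
proof -
  let ?f = "to_fract :: 'p padic_int \<Rightarrow> 'p padic"
  have nz: "x \<noteq> 0" if "\<not> pp dvd x" for x :: "'p padic_int" using that by auto
  note sym = to_fract_pochhammer[symmetric]
  have bal': "1 + ?f d + ?f e = 1 - of_nat n + ?f r + ?f b + ?f c"
    using arg_cong[OF bal, of ?f] by (simp add: algebra_simps)
  have D: "1 - of_nat n - (?f d - ?f r) = 1 + ?f e - ?f b - ?f c"
    "1 - of_nat n - (?f e - ?f r) = 1 + ?f d - ?f b - ?f c"
    using bal' by (simp_all add: algebra_simps)
  have "pochhammer (1 - of_nat n - (?f d - ?f r)) n \<noteq> 0" "pochhammer (1 - of_nat n - (?f e - ?f r)) n \<noteq> 0"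
    unfolding pochhammer_reflect using nz[OF dr] nz[OF er] by (simp_all add: sym flip: to_fract_diff)
  moreover have "pochhammer (?f d) n \<noteq> 0" "pochhammer (?f e) n \<noteq> 0"
    using nz[OF d] nz[OF e] by (simp_all add: sym)
  moreover have "pochhammer 1 n \<noteq> (0 :: 'p padic)" by (simp flip: pochhammer_fact)
  ultimately have W: "hypergeom_trunc [?f r, - of_nat n, ?f b, ?f c] [1, ?f d, ?f e] 1 n
      = pochhammer (?f d - ?f r) n * pochhammer (?f e - ?f r) n / (pochhammer (?f d) n * pochhammer (?f e) n)
        * hypergeom_trunc [?f r, - of_nat n, 1 - ?f b, 1 - ?f c]
            [1, 1 + ?f d - ?f b - ?f c, 1 + ?f e - ?f b - ?f c] 1 n"
    using whipple_transformation[OF bal'] unfolding D hypergeom_trunc_4F3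
    by (simp add: mult_ac flip: pochhammer_fact)
  \<comment> \<open>By balancing, the gamma arguments fall into four pairs that differ by
    \<open>n\<close>; the other two pairs are \<open>d\<close>, \<open>d - (- n)\<close> and
    \<open>e\<close>, \<open>e - (- n)\<close>.\<close>
  have arg: "b + c - e = (d - r) + of_nat n" "b + c - d = (e - r) + of_nat n"
    using bal by (simp_all add: algebra_simps)
  have sq: "(-1 :: 'p padic) ^ n * (-1) ^ n = 1" by (simp flip: power_mult_distrib)
  have m1: "?f ((-1) ^ n) = (-1) ^ n" by (induction n) simp_all
  have G: "Gamma_quotient r (- of_nat n) b c d e
      = pochhammer (?f d - ?f r) n * pochhammer (?f e - ?f r) n / (pochhammer (?f d) n * pochhammer (?f e) n)"
  proof -
    define g where "g x = ?f (padic_Gamma x)" for x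
    have g0: "g x \<noteq> 0" for x using nz[OF not_pp_dvd_padic_Gamma[OF p]] by (simp add: g_def)
    have g: "?f (padic_Gamma (x + of_nat n)) = (-1) ^ n * ?f (pochhammer x n) * g x" if "\<not> pp dvd pochhammer x n" for x
      unfolding padic_Gamma_plus_of_nat[OF p that] by (simp add: g_def m1)
    have "Gamma_quotient r (- of_nat n) b c d e
        = (((-1) ^ n * ?f (pochhammer (e - r) n) * g (e - r)) * ((-1) ^ n * ?f (pochhammer (d - r) n) * g (d - r)) * g d * g e)
        / (g (d - r) * g (e - r) * ((-1) ^ n * ?f (pochhammer d n) * g d) * ((-1) ^ n * ?f (pochhammer e n) * g e))"
      unfolding Gamma_quotient_def arg to_fract_mult diff_minus_eq_add g[OF d] g[OF e] g[OF dr] g[OF er]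
      by (simp add: g_def)
    also have "\<dots> = ?f (pochhammer (d - r) n) * ?f (pochhammer (e - r) n) / (?f (pochhammer d n) * ?f (pochhammer e n))"
      using g0 by (simp add: field_simps)
    finally show ?thesis by (simp add: to_fract_pochhammer)
  qed
  show ?thesis
    using W by (simp add: G hypergeom_trunc_terminating[OF M])
qed

lemma Gamma_quotient_commute: "Gamma_quotient r a b c d e = Gamma_quotient a r b c d e"
  by (simp add: Gamma_quotient_def mult_ac)

lemma hypergeom_trunc_commute:
  "hypergeom_trunc [r, a, b, c] [1, d, e] 1 n = hypergeom_trunc [a, r, b, c] [1, d, e] 1 n"
  "hypergeom_trunc [r, a, b, c] [1, d, e] 1 n = hypergeom_trunc [r, a, c, b] [1, d, e] 1 n"
  by (simp_all add: hypergeom_trunc_4F3 mult_ac)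

section \<open>Interpolation between the two terminating cases\<close>

lemma padic_affine_Gamma_line:
  fixes x y z k :: "'p :: prime_card padic_int"
  assumes "odd CARD('p)" "x = y + pp * k" "z = y - pp * k"
  shows "padic_affine (padic_Gamma x) (padic_Gamma y) (padic_Gamma z)"
  unfolding assms(2,3) by (rule padic_affine_Gamma[OF assms(1)])

lemma padic_residue_neg:
  fixes x :: "'p :: prime_card padic_int"
  shows "padic_residue (- x) < CARD('p)" "pp dvd x + of_nat (padic_residue (- x))"
proof -
  have *: "padic_residue (- x) < CARD('p) \<and> pp dvd - x - of_nat (padic_residue (- x))"
    unfolding padic_residue_def by (rule theI'[OF padic_residue_unique])
  then show "padic_residue (- x) < CARD('p)" by simp
  have "- x - of_nat (padic_residue (- x)) = - (x + of_nat (padic_residue (- x)))" by simp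
  then show "pp dvd x + of_nat (padic_residue (- x))" using * by (metis dvd_minus_iff)
qed

theorem theorem2p14:
  fixes p :: nat
    and \<alpha> \<beta> \<gamma> \<delta> \<epsilon> \<rho> :: "'p :: prime_card padic_int"
  assumes "p = CARD('p)" and "prime p" and "odd p"
    and "padic_residue (- \<alpha>) \<le> min (padic_residue (- \<delta>)) (padic_residue (- \<epsilon>))"
    and "padic_residue (- \<beta>) \<le> padic_residue (- \<delta>)"
    and "padic_residue (- \<gamma>) \<le> padic_residue (- \<epsilon>)"
    and "padic_residue (- \<alpha>) + padic_residue (- \<beta>) + padic_residue (- \<gamma>)
           \<le> padic_residue (- \<delta>) + padic_residue (- \<epsilon>)"
    and "padic_residue (- \<beta>) + padic_residue (- \<gamma>)
           \<ge> max (padic_residue (- \<delta>)) (padic_residue (- \<epsilon>))"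
    and "\<not> of_nat p ^ 2 dvd pochhammer \<delta> (p - 1)"
    and "\<not> of_nat p ^ 2 dvd pochhammer \<epsilon> (p - 1)"
    and "\<not> of_nat p ^ 2 dvd pochhammer (1 + \<delta> - \<beta> - \<gamma>) (p - 1)"
    and "\<not> of_nat p ^ 2 dvd pochhammer (1 + \<epsilon> - \<beta> - \<gamma>) (p - 1)"
    and "\<rho> = \<delta> + \<epsilon> - \<alpha> - \<beta> - \<gamma>"
  shows "padic_cong 2
    (hypergeom_trunc (map to_fract [\<rho>, \<alpha>, \<beta>, \<gamma>]) (map to_fract [1, \<delta>, \<epsilon>]) 1 (p - 1))
    (to_fract (padic_Gamma (\<beta> + \<gamma> - \<delta>) * padic_Gamma (\<beta> + \<gamma> - \<epsilon>)
               * padic_Gamma \<delta> * padic_Gamma \<epsilon>)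
     / to_fract (padic_Gamma (\<delta> - \<rho>) * padic_Gamma (\<epsilon> - \<rho>)
               * padic_Gamma (\<delta> - \<alpha>) * padic_Gamma (\<epsilon> - \<alpha>))
     * hypergeom_trunc (map to_fract [\<rho>, \<alpha>, 1 - \<beta>, 1 - \<gamma>])
         (map to_fract [1, 1 + \<delta> - \<beta> - \<gamma>, 1 + \<epsilon> - \<beta> - \<gamma>]) 1 (p - 1))"
proof -
  note p = assms(1)
  have odd: "odd CARD('p)" using assms(1,3) by simp
  define a b c d e where defs: "a = padic_residue (- \<alpha>)" "b = padic_residue (- \<beta>)"
    "c = padic_residue (- \<gamma>)" "d = padic_residue (- \<delta>)" "e = padic_residue (- \<epsilon>)"
  have lt: "a < p" "b < p" "c < p" "d < p" "e < p"
    unfolding defs p by (rule padic_residue_neg)+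
  have dvd: "pp dvd \<alpha> + of_nat a" "pp dvd \<beta> + of_nat b" "pp dvd \<gamma> + of_nat c"
    "pp dvd \<delta> + of_nat d" "pp dvd \<epsilon> + of_nat e"
    unfolding defs by (rule padic_residue_neg)+
  have le: "a \<le> d" "a \<le> e" "b \<le> d" "c \<le> e" "a + b + c \<le> d + e" "d \<le> b + c" "e \<le> b + c"
    using assms(4-8) unfolding defs by simp_all
  \<comment> \<open>Condition (ii) keeps this subtraction from truncating. Condition (iii) gives
    \<open>r + a \<le> d\<close> and \<open>r + a \<le> e\<close>.\<close>
  define r where "r = d + e - a - b - c"
  have r: "r + a + b + c = d + e" using le by (simp add: r_def)
  obtain sa sb sc sd se where s: "\<alpha> + of_nat a = pp * sa" "\<beta> + of_nat b = pp * sb" "\<gamma> + of_nat c = pp * sc"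
    "\<delta> + of_nat d = pp * sd" "\<epsilon> + of_nat e = pp * se"
    using dvd by (auto elim!: dvdE)
  define q where "q = sd + se - sa - sb - sc"
  have rr: "of_nat r + of_nat a + of_nat b + of_nat c = (of_nat d + of_nat e :: 'p padic_int)"
    using r by (metis of_nat_add)
  have rho: "\<rho> + of_nat r = pp * q"
  proof -
    have "pp * q = (\<delta> + of_nat d) + (\<epsilon> + of_nat e) - (\<alpha> + of_nat a) - (\<beta> + of_nat b) - (\<gamma> + of_nat c)"
      unfolding s q_def by (simp add: algebra_simps)
    also have "\<dots> = \<rho> + of_nat r" using rr assms(13) by (simp add: algebra_simps)
    finally show ?thesis ..
  qed
  define M where "M = max a r"
  \<comment> \<open>The residues of the negatives of the lower parameters on the right. Condition
    (iii) makes \<open>b + c - d\<close> exact, and \<open>b \<le> d\<close> bounds it by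
    \<open>c\<close>; similarly for \<open>e\<close>.\<close>
  define d' e' where "d' = p - 1 - (b + c - d)" and "e' = p - 1 - (b + c - e)"
  have d': "d' + (b + c + 1) = p + d" and e': "e' + (b + c + 1) = p + e"
    using le lt unfolding d'_def e'_def by linarith+
  \<comment> \<open>For the last bounds: \<open>d' - r = p - 1 - e + a\<close>, and (ii) with
    \<open>e \<le> p - 1\<close> gives \<open>a \<le> d'\<close>; \<open>e'\<close> is
    symmetric.\<close>
  have M: "M < p" "M \<le> d" "M \<le> e" "M \<le> d'" "M \<le> e'"
    using le lt r d' e' by (auto simp: M_def)
  \<comment> \<open>Replaces a possibly negative representative \<open>i\<close> by a natural number
    congruent to it modulo \<open>p\<close>.\<close>
  have dvd_shift: "pp dvd x + of_nat n"
    if "int n = i + int p * j" "x + of_int i = pp * t" for x t :: "'p padic_int" and n i j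
  proof -
    have "(of_nat n :: 'p padic_int) = of_int i + pp * of_int j"
      using arg_cong[OF that(1), of "of_int :: int \<Rightarrow> 'p padic_int"] p by simp
    then have "x + of_nat n = pp * (t + of_int j)" using that(2) by (simp add: algebra_simps)
    then show ?thesis by simp
  qed
  have dvd':
    "pp dvd 1 + \<delta> - \<beta> - \<gamma> + of_nat d'" "pp dvd 1 + \<epsilon> - \<beta> - \<gamma> + of_nat e'"
    "pp dvd 1 - \<beta> + of_nat (p - 1 - b)" "pp dvd 1 - \<gamma> + of_nat (p - 1 - c)"
  proof -
    show "pp dvd 1 + \<delta> - \<beta> - \<gamma> + of_nat d'"
      by (rule dvd_shift[of d' "int d - int b - int c - 1" 1 _ "sd - sb - sc"])
        (use d' s in \<open>simp_all add: algebra_simps\<close>)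
    show "pp dvd 1 + \<epsilon> - \<beta> - \<gamma> + of_nat e'"
      by (rule dvd_shift[of e' "int e - int b - int c - 1" 1 _ "se - sb - sc"])
        (use e' s in \<open>simp_all add: algebra_simps\<close>)
    show "pp dvd 1 - \<beta> + of_nat (p - 1 - b)"
      by (rule dvd_shift[of _ "- int b - 1" 1 _ "- sb"])
        (use lt s in \<open>simp_all add: of_nat_diff algebra_simps\<close>)
    show "pp dvd 1 - \<gamma> + of_nat (p - 1 - c)"
      by (rule dvd_shift[of _ "- int c - 1" 1 _ "- sc"])
        (use lt s in \<open>simp_all add: of_nat_diff algebra_simps\<close>)
  qed
  define L where "L \<rho> \<alpha> \<delta> n = hypergeom_trunc (map to_fract [\<rho>, \<alpha>, \<beta>, \<gamma>]) (map to_fract [1, \<delta>, \<epsilon>]) 1 n"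
    for \<rho> \<alpha> \<delta> n
  define R where "R \<rho> \<alpha> \<delta> n = hypergeom_trunc (map to_fract [\<rho>, \<alpha>, 1 - \<beta>, 1 - \<gamma>])
     (map to_fract [1, 1 + \<delta> - \<beta> - \<gamma>, 1 + \<epsilon> - \<beta> - \<gamma>]) 1 n" for \<rho> \<alpha> \<delta> n
  define G where "G \<rho> \<alpha> \<delta> = Gamma_quotient \<rho> \<alpha> \<beta> \<gamma> \<delta> \<epsilon>" for \<rho> \<alpha> \<delta>

  have L: "padic_cong 2 (L \<rho> \<alpha> \<delta> (p - 1)) (L \<rho> \<alpha> \<delta> M)"
    unfolding L_def p
    by (rule hypergeom_trunc_cong[of _ r _ _ a _ b _ c _ d _ e])
      (use dvd rho le lt M assms(9,10) in \<open>auto simp: M_def simp flip: p\<close>)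
  \<comment> \<open>On this side \<open>1 - \<gamma>\<close> is paired with
    \<open>1 + \<delta> - \<beta> - \<gamma>\<close>, since \<open>p - 1 - c \<le> d'\<close>
    amounts to \<open>b \<le> d\<close>; hence the exchange of the last two upper
    parameters.\<close>
  have R: "padic_cong 2 (R \<rho> \<alpha> \<delta> (p - 1)) (R \<rho> \<alpha> \<delta> M)"
  proof -
    have "padic_cong 2 (hypergeom_trunc (map to_fract [\<rho>, \<alpha>, 1 - \<gamma>, 1 - \<beta>])
         (map to_fract [1, 1 + \<delta> - \<beta> - \<gamma>, 1 + \<epsilon> - \<beta> - \<gamma>]) 1 (CARD('p) - 1))
       (hypergeom_trunc (map to_fract [\<rho>, \<alpha>, 1 - \<gamma>, 1 - \<beta>])
         (map to_fract [1, 1 + \<delta> - \<beta> - \<gamma>, 1 + \<epsilon> - \<beta> - \<gamma>]) 1 M)"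
      by (rule hypergeom_trunc_cong[of _ r _ _ a _ "p - 1 - c" _ "p - 1 - b" _ d' _ e'])
        (use dvd dvd' rho le lt M d' e' assms(11,12) in \<open>auto simp: M_def simp flip: p\<close>)
    then show ?thesis
      by (simp only: R_def p list.map to_fract_1 hypergeom_trunc_commute(2)[of _ _ "to_fract (1 - \<gamma>)"])
  qed

  \<comment> \<open>Suffixes \<open>1\<close> and \<open>2\<close> mark the values at the parameters \<open>1\<close> and \<open>-1\<close> of the line.\<close>
  define \<alpha>1 \<alpha>2 \<rho>1 \<rho>2 \<delta>1 \<delta>2 where lines:
    "\<alpha>1 = (- of_nat a :: 'p padic_int)" "\<alpha>2 = \<alpha> + pp * sa"
    "\<rho>1 = \<rho> + pp * q" "\<rho>2 = (- of_nat r :: 'p padic_int)"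
    "\<delta>1 = \<delta> + pp * (q - sa)" "\<delta>2 = \<delta> - pp * (q - sa)"
  \<comment> \<open>The slopes of \<open>\<alpha>\<close> and \<open>\<rho>\<close> are
    \<open>- sa\<close> and \<open>q\<close>; their sum is the slope of \<open>\<delta>\<close>, so
    the balancing condition persists along the line.\<close>
  have \<alpha>1: "\<alpha>1 = \<alpha> - pp * sa" and \<rho>2: "\<rho>2 = \<rho> - pp * q"
    using s(1) rho by (simp_all add: lines algebra_simps)
  have aff: "padic_affine \<alpha>1 \<alpha> \<alpha>2" "padic_affine \<rho>1 \<rho> \<rho>2" "padic_affine \<delta>1 \<delta> \<delta>2"
    using padic_affine_line[of \<alpha> "- sa"] padic_affine_line[of \<rho> q] padic_affine_line[of \<delta> "q - sa"]
    by (simp_all add: \<alpha>1 \<rho>2 lines)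
  have affL: "fract_affine (L \<rho>1 \<alpha>1 \<delta>1 M) (L \<rho> \<alpha> \<delta> M) (L \<rho>2 \<alpha>2 \<delta>2 M)"
    unfolding L_def using aff dvd lt M
    by (intro fract_affine_hypergeom_trunc[where md = d and me = e] padic_affine_const) (simp_all add: p)
  have affD: "padic_affine (1 + \<delta>1 - \<beta> - \<gamma>) (1 + \<delta> - \<beta> - \<gamma>) (1 + \<delta>2 - \<beta> - \<gamma>)"
    using padic_affine_line[of "1 + \<delta> - \<beta> - \<gamma>" "q - sa"] by (simp add: lines algebra_simps)
  have affR: "fract_affine (R \<rho>1 \<alpha>1 \<delta>1 M) (R \<rho> \<alpha> \<delta> M) (R \<rho>2 \<alpha>2 \<delta>2 M)"
    unfolding R_def using aff affD dvd' lt M d' e' le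
    by (intro fract_affine_hypergeom_trunc[where md = d' and me = e'] padic_affine_const)
      (simp_all flip: p)
  \<comment> \<open>Every gamma argument moves along a line in a direction divisible by
    \<open>p\<close>; the witnesses below are its slopes, combined from \<open>- sa\<close>,
    \<open>q\<close> and \<open>q - sa\<close>.\<close>
  have affG: "fract_affine (G \<rho>1 \<alpha>1 \<delta>1) (G \<rho> \<alpha> \<delta>) (G \<rho>2 \<alpha>2 \<delta>2)"
  proof -
    have "\<not> pp dvd padic_Gamma (\<delta> - \<rho>) * padic_Gamma (\<epsilon> - \<rho>) * padic_Gamma (\<delta> - \<alpha>) * padic_Gamma (\<epsilon> - \<alpha>)"
      using not_pp_dvd_padic_Gamma[OF odd] by (simp add: prime_elem_dvd_mult_iff[OF prime_elem_pp])
    moreover note line = padic_affine_Gamma_line[OF odd]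
    have "padic_affine (padic_Gamma (\<beta> + \<gamma> - \<delta>1)) (padic_Gamma (\<beta> + \<gamma> - \<delta>)) (padic_Gamma (\<beta> + \<gamma> - \<delta>2))"
      by (rule line[of _ _ "sa - q"]) (simp_all add: lines algebra_simps)
    moreover have "padic_affine (padic_Gamma \<delta>1) (padic_Gamma \<delta>) (padic_Gamma \<delta>2)"
      by (rule line[of _ _ "q - sa"]) (simp_all add: lines)
    moreover have "padic_affine (padic_Gamma (\<delta>1 - \<rho>1)) (padic_Gamma (\<delta> - \<rho>)) (padic_Gamma (\<delta>2 - \<rho>2))"
      unfolding \<rho>2 by (rule line[of _ _ "- sa"]) (simp_all add: lines algebra_simps)
    moreover have "padic_affine (padic_Gamma (\<epsilon> - \<rho>1)) (padic_Gamma (\<epsilon> - \<rho>)) (padic_Gamma (\<epsilon> - \<rho>2))"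
      unfolding \<rho>2 by (rule line[of _ _ "- q"]) (simp_all add: lines algebra_simps)
    moreover have "padic_affine (padic_Gamma (\<delta>1 - \<alpha>1)) (padic_Gamma (\<delta> - \<alpha>)) (padic_Gamma (\<delta>2 - \<alpha>2))"
      unfolding \<alpha>1 by (rule line[of _ _ q]) (simp_all add: lines algebra_simps)
    moreover have "padic_affine (padic_Gamma (\<epsilon> - \<alpha>1)) (padic_Gamma (\<epsilon> - \<alpha>)) (padic_Gamma (\<epsilon> - \<alpha>2))"
      unfolding \<alpha>1 by (rule line[of _ _ sa]) (simp_all add: lines algebra_simps)
    ultimately show ?thesis
      unfolding G_def Gamma_quotient_def
      by (intro fract_affine_divide fract_affine_to_fract padic_affine_mult padic_affine_const)
  qed
  have unit: "\<not> pp dvd pochhammer x n"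
    if "x + of_nat m = pp * t" "n \<le> m" "m < p" for x t :: "'p padic_int" and m n
    using pp_dvd_pochhammer_iff[of x m n] that p by simp
  have s': "\<alpha> = pp * sa - of_nat a" "\<beta> = pp * sb - of_nat b" "\<gamma> = pp * sc - of_nat c"
    "\<delta> = pp * sd - of_nat d" "\<epsilon> = pp * se - of_nat e" "\<rho> = pp * q - of_nat r"
    using s rho by (simp_all add: eq_diff_eq)
  have nat_diff: "of_nat (x - y) = (of_nat x - of_nat y :: 'p padic_int)" if "y \<le> x" for x y
    using that by (rule of_nat_diff)
  have zero1: "L \<rho>1 \<alpha>1 \<delta>1 M = G \<rho>1 \<alpha>1 \<delta>1 * R \<rho>1 \<alpha>1 \<delta>1 M"
    unfolding L_def G_def R_def lines(1)
  proof (rule padic_whipple[OF odd])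
    show "\<delta>1 + \<epsilon> = \<rho>1 - of_nat a + \<beta> + \<gamma>"
      using assms(13) by (simp add: lines right_diff_distrib s(1)[symmetric])
    show "\<not> pp dvd pochhammer \<delta>1 a"
      by (rule unit[of _ d "sd + q - sa"]) (use le lt in \<open>simp_all add: lines s' algebra_simps\<close>)
    show "\<not> pp dvd pochhammer \<epsilon> a"
      by (rule unit[of _ e se]) (use le lt s in simp_all)
    \<comment> \<open>The residue of \<open>\<rho>1 - \<delta>1\<close> is
      \<open>d - r = a + b + c - e\<close>, at least \<open>a\<close> by condition (iii). The next
      case is the same with \<open>d\<close> and \<open>e\<close> exchanged.\<close>
    show "\<not> pp dvd pochhammer (\<delta>1 - \<rho>1) a"
    proof (rule unit[of _ "a + b + c - e" "sd - q - sa"])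
      have "of_nat (a + b + c - e) = (of_nat d - of_nat r :: 'p padic_int)"
        using rr le by (simp add: nat_diff algebra_simps)
      then show "\<delta>1 - \<rho>1 + of_nat (a + b + c - e) = pp * (sd - q - sa)"
        by (simp add: lines s' algebra_simps)
    qed (use le lt in linarith)+
    show "\<not> pp dvd pochhammer (\<epsilon> - \<rho>1) a"
    proof (rule unit[of _ "a + b + c - d" "se - 2 * q"])
      have "of_nat (a + b + c - d) = (of_nat e - of_nat r :: 'p padic_int)"
        using rr le by (simp add: nat_diff algebra_simps)
      then show "\<epsilon> - \<rho>1 + of_nat (a + b + c - d) = pp * (se - 2 * q)"
        by (simp add: lines s' algebra_simps)
    qed (use le lt in linarith)+
    show "a \<le> M" by (simp add: M_def)
  qed
  have swap: "hypergeom_trunc (map to_fract [x, y, u, v]) (map to_fract [1, w, z]) 1 n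
      = hypergeom_trunc (map to_fract [y, x, u, v]) (map to_fract [1, w, z]) 1 n"
    for x y u v w z :: "'p padic_int" and n
    by (simp only: list.map to_fract_1) (rule hypergeom_trunc_commute(1))
  \<comment> \<open>Here \<open>\<rho>2\<close> terminates the series, so \<open>\<rho>\<close> and
    \<open>\<alpha>\<close> exchange roles. The required \<open>r \<le> d - a\<close> and
    \<open>r \<le> e - a\<close> come from condition (iii).\<close>
  have zero2: "L \<rho>2 \<alpha>2 \<delta>2 M = G \<rho>2 \<alpha>2 \<delta>2 * R \<rho>2 \<alpha>2 \<delta>2 M"
    unfolding L_def G_def R_def lines(4) swap[of "- of_nat r"] Gamma_quotient_commute[of "- of_nat r"]
  proof (rule padic_whipple[OF odd])
    show "\<delta>2 + \<epsilon> = \<alpha>2 - of_nat r + \<beta> + \<gamma>"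
      using assms(13) by (simp add: lines right_diff_distrib s(1)[symmetric] rho[symmetric])
    show "\<not> pp dvd pochhammer \<delta>2 r"
      by (rule unit[of _ d "sd - q + sa"]) (use M lt in \<open>simp_all add: M_def lines s' algebra_simps\<close>)
    show "\<not> pp dvd pochhammer \<epsilon> r"
      by (rule unit[of _ e se]) (use M lt s in \<open>simp_all add: M_def\<close>)
    show "\<not> pp dvd pochhammer (\<delta>2 - \<alpha>2) r"
      by (rule unit[of _ "d - a" "sd - q - sa"])
        (use r le lt in \<open>simp_all add: lines s' nat_diff algebra_simps\<close>)
    show "\<not> pp dvd pochhammer (\<epsilon> - \<alpha>2) r"
      by (rule unit[of _ "e - a" "se - 2 * sa"])
        (use r le lt in \<open>simp_all add: lines s' nat_diff algebra_simps\<close>)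
    show "r \<le> M" by (simp add: M_def)
  qed
  have "fract_affine 0 (L \<rho> \<alpha> \<delta> M - G \<rho> \<alpha> \<delta> * R \<rho> \<alpha> \<delta> M) 0"
    using fract_affine_diff[OF affL fract_affine_mult[OF affG affR]] by (simp add: zero1 zero2)
  then obtain y where y: "L \<rho> \<alpha> \<delta> M - G \<rho> \<alpha> \<delta> * R \<rho> \<alpha> \<delta> M = to_fract y" "padic_affine 0 y 0"
    unfolding fract_affine_def by (metis to_fract_eq_0_iff)
  then have mid: "padic_cong 2 (L \<rho> \<alpha> \<delta> M) (G \<rho> \<alpha> \<delta> * R \<rho> \<alpha> \<delta> M)"
    using padic_affine_middle[OF odd y(2)] unfolding padic_cong_def by (auto elim!: dvdE)
  \<comment> \<open>Integrality of the gamma quotient, contained in \<open>affG\<close>, allows the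
    congruence for \<open>R\<close> to be multiplied by it.\<close>
  obtain g where g: "G \<rho> \<alpha> \<delta> = to_fract g" using affG unfolding fract_affine_def by blast
  have "padic_cong 2 (G \<rho> \<alpha> \<delta> * R \<rho> \<alpha> \<delta> M) (G \<rho> \<alpha> \<delta> * R \<rho> \<alpha> \<delta> (p - 1))"
    unfolding g by (rule padic_cong_mult_left[OF padic_cong_sym[OF R]])
  from padic_cong_trans[OF padic_cong_trans[OF L mid] this] show ?thesis
    unfolding L_def G_def R_def Gamma_quotient_def .
qed

end
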